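(* Let $g\in\mathbb N$. (a) Let $f\in\mathbb C\langle X_1,\dots,X_g,X_1^{\intercal},\dots,X_g^{\intercal}\rangle$. If $f(A,A^* )=0$ for all $n\in\mathbb N$ and all $A=(A_1,\dots,A_g)\in M_n(\mathbb C)^g$ with every $A_j$ unitary, then $f\in(1-X_1X_1^{\intercal},\,1-X_1^{\intercal}X_1,\,\dots,\,1-X_gX_g^{\intercal},\,1-X_g^{\intercal}X_g)$. (b) Let $g\ge2$ and $f\in\mathbb C\langle X_1,\dots,X_g,X_1^{\intercal},\dots,X_g^{\intercal}\rangle$. If $f(A,A^* )=0$ for all $n\in\mathbb N$ and all $A\in M_n(\mathbb C)^g$ with $A_1A_1^*+\cdots+A_gA_g^*=I_n$, then $f\in(1-X_1X_1^{\intercal}-\cdots-X_gX_g^{\intercal})$. (c) Let $f\in\mathbb C\langle X_{ij},X_{ij}^{\intercal}:1\le i,j\le g\rangle$. If $f(A,A^* )=0$ for all $n\in\mathbb N$ and all $A=(A_{ij})\in M_n(\mathbb C)^{g^2}$ such that the $gn\times gn$ block matrix $(A_{ij})_{ij}$ is unitary, then $$f\in\Big(\delta_{ij}-\sum_{k=1}^gX_{ik}X_{jk}^{\intercal},\ \delta_{ij}-\sum_{k=1}^gX_{ki}^{\intercal}X_{kj}\ :\ 1\le i,j\le g\Big).$$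
   Context: $\mathbb C\langle\cdots\rangle$ is the free associative unital $\mathbb C$-algebra in the listed freely noncommuting letters, with the conjugate-linear involution ${}^{\intercal}$ exchanging each letter $X$ with $X^{\intercal}$. The evaluation $f(A,A^* )$ replaces each letter $X$ by the corresponding matrix $A$ and $X^{\intercal}$ by the conjugate transpose $A^*$. $(\cdots)$ denotes the two-sided ideal generated by the listed elements; $\delta_{ij}$ is Kronecker's delta. *)

theory Defs
  imports
    "HOL-Library.Poly_Mapping"
    "HOL-Algebra.Ideal"
    "Jordan_Normal_Form.Schur_Decomposition"
begin

(* Var i stands for the letter X_i and Adj i for the letter X_i^T. *)
datatype 'i letter = Var 'i | Adj 'i

fun letter_index :: "'i letter \<Rightarrow> 'i" where
  "letter_index (Var i) = i"
| "letter_index (Adj i) = i"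

(* Lists under concatenation form the free monoid (written additively, as Poly_Mapping
   requires), so 'i letter list \<Rightarrow>\<^sub>0 complex with its convolution product is the
   free associative algebra on the letters. *)
instantiation list :: (type) monoid_add
begin

definition zero_list :: "'a list" where "zero_list = []"
definition plus_list :: "'a list \<Rightarrow> 'a list \<Rightarrow> 'a list" where "plus_list = append"

instance by standard (simp_all add: zero_list_def plus_list_def)

end

type_synonym 'i star_poly = "'i letter list \<Rightarrow>\<^sub>0 complex"

definition var :: "'i \<Rightarrow> 'i star_poly" where
  "var i = Poly_Mapping.single [Var i] 1"

definition avar :: "'i \<Rightarrow> 'i star_poly" where
  "avar i = Poly_Mapping.single [Adj i] 1"

(* The free algebra on the letters X_i, X_i^T with i ranging over I only. *)
definition free_star_algebra :: "'i set \<Rightarrow> 'i star_poly ring" where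
  "free_star_algebra I =
     \<lparr>carrier = {f. \<forall>w\<in>Poly_Mapping.keys f. letter_index ` set w \<subseteq> I},
      monoid.mult = (*), one = 1, ring.zero = 0, add = (+)\<rparr>"

lemma ring_free_star_algebra: "ring (free_star_algebra I)"
proof -
  let ?C = "{f :: 'a star_poly. \<forall>w\<in>Poly_Mapping.keys f. letter_index ` set w \<subseteq> I}"
  have add: "f + h \<in> ?C" if "f \<in> ?C" "h \<in> ?C" for f h
    using that Poly_Mapping.keys_add[of f h] by blast
  have mult: "f * h \<in> ?C" if "f \<in> ?C" "h \<in> ?C" for f h
  proof
    show "\<forall>w\<in>Poly_Mapping.keys (f * h). letter_index ` set w \<subseteq> I"
    proof
      fix w assume "w \<in> Poly_Mapping.keys (f * h)"
      then obtain u v where uv: "w = u + v" "u \<in> Poly_Mapping.keys f"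
          "v \<in> Poly_Mapping.keys h"
        using keys_mult[of f h] by blast
      then show "letter_index ` set w \<subseteq> I"
        using that by (simp add: plus_list_def image_Un)
    qed
  qed
  have neg: "- f \<in> ?C" if "f \<in> ?C" for f
    using that by simp
  have zero: "(0 :: 'a star_poly) \<in> ?C" by simp
  have one: "(1 :: 'a star_poly) \<in> ?C" by (simp add: zero_list_def)
  have inv: "\<exists>h\<in>?C. h + f = 0" if "f \<in> ?C" for f
    using neg[OF that] by (intro bexI[of _ "- f"]) simp_all
  have *: "carrier (free_star_algebra I) = ?C" "x \<oplus>\<^bsub>free_star_algebra I\<^esub> y = x + y"
    "x \<otimes>\<^bsub>free_star_algebra I\<^esub> y = x * y" "\<zero>\<^bsub>free_star_algebra I\<^esub> = 0"
    "\<one>\<^bsub>free_star_algebra I\<^esub> = 1" for x y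
    by (simp_all add: free_star_algebra_def)
  show ?thesis
  proof (rule ringI)
    show "abelian_group (free_star_algebra I)"
      by (rule abelian_groupI; unfold *)
        (rule add zero inv add.assoc add.commute add_0_left; assumption?)+
    show "monoid (free_star_algebra I)"
      by (rule monoidI; unfold *)
        (rule mult one mult.assoc mult_1_left mult_1_right; assumption?)+
  qed (simp_all only: * distrib_left distrib_right)
qed

fun letter_eval :: "('i \<Rightarrow> complex mat) \<Rightarrow> 'i letter \<Rightarrow> complex mat" where
  "letter_eval A (Var i) = A i"
| "letter_eval A (Adj i) = mat_adjoint (A i)"

definition word_eval :: "nat \<Rightarrow> ('i \<Rightarrow> complex mat) \<Rightarrow> 'i letter list \<Rightarrow> complex mat" where
  "word_eval n A w = foldr (\<lambda>l M. letter_eval A l * M) w (1\<^sub>m n)"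

(* f(A,A^* ), where the A i are n x n matrices *)
definition star_eval :: "nat \<Rightarrow> ('i \<Rightarrow> complex mat) \<Rightarrow> 'i star_poly \<Rightarrow> complex mat" where
  "star_eval n A f =
     (\<Oplus>\<^bsub>ring_mat TYPE(complex) n ()\<^esub>w\<in>Poly_Mapping.keys f.
        Poly_Mapping.lookup f w \<cdot>\<^sub>m word_eval n A w)"

definition unitary_mat :: "nat \<Rightarrow> complex mat \<Rightarrow> bool" where
  "unitary_mat n U \<longleftrightarrow>
     U \<in> carrier_mat n n \<and> U * mat_adjoint U = 1\<^sub>m n \<and> mat_adjoint U * U = 1\<^sub>m n"

(* Blocks are indexed by {1..g} x {1..g}, matrix entries from 0. *)
definition block_matrix :: "nat \<Rightarrow> nat \<Rightarrow> (nat \<times> nat \<Rightarrow> complex mat) \<Rightarrow> complex mat" where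
  "block_matrix g n A =
     mat (g * n) (g * n) (\<lambda>(r, c). A (r div n + 1, c div n + 1) $$ (r mod n, c mod n))"

end

theory Submission
  imports Defs
begin

text \<open>
  Let \<open>J\<close> be one of the three ideals and let \<open>f \<notin> J\<close>; a tuple of matrices satisfying the relations with
  \<open>f(A, A\<^sup>*) \<noteq> 0\<close> has to be found. The construction has two halves, and positivity enters only in the second.

  Forget first that \<open>A\<^sup>*\<close> is the adjoint of \<open>A\<close>, and look for a pair of mutually inverse matrices \<open>G\<close>, \<open>G\<^sup>-\<^sup>1\<close>
  whose blocks are substituted for the letters \<open>X\<close> and \<open>X\<^sup>\<intercal>\<close>. The quotient algebra acts on itself by left
  multiplication, and there the relations of unitarity say that the block matrix of letters \<open>X\<close> is invertible with inverse
  formed by the letters \<open>X\<^sup>\<intercal>\<close>. Restricted to classes of polynomials of bounded degree this action is a linear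
  injection between subspaces of a finite-dimensional space, and there it extends to an invertible matrix \<open>G\<close>
  (\<open>partial_injection_extends_to_invertible_matrix\<close>). As long as the degree stays below the cut-off, the extension
  is not seen: the blocks of \<open>G\<close> and \<open>G\<^sup>-\<^sup>1\<close> move the class of \<open>1\<close> along each word exactly as left multiplication
  does. Hence \<open>f\<close> evaluated at these blocks sends the class of \<open>1\<close> to the class of \<open>f\<close>, which is not zero
  (\<open>coordinates_vanish\<close>).

  Now return to unitary matrices. A Cayley transform puts \<open>G\<close> on a path of matrices with rational entries that is
  unitary at almost all real parameters and passes through \<open>G\<close> at the parameter \<open>\<i>\<close> (\<open>unitary_rational_path\<close>).
  Along this path the entries of \<open>f\<close> are rational functions. If \<open>f\<close> vanished on all unitary matrices, they would
  vanish at almost all real parameters, hence at \<open>\<i>\<close>, which contradicts the previous paragraph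
  (\<open>vanishing_extends_to_inverse_pairs\<close>).

  For the relations of single unitaries there is one matrix \<open>G\<close> for each letter; for a unitary block matrix there is one
  matrix \<open>G\<close> altogether. The relation \<open>\<Sum>\<^sub>j X\<^sub>j X\<^sub>j\<^sup>\<intercal> = 1\<close> only says that the row \<open>(X\<^sub>1, \<dots>, X\<^sub>g)\<close> has the column
  with entries \<open>X\<^sub>j\<^sup>\<intercal>\<close> as a right inverse. Such a row is completed to an invertible square matrix by recording
  in the second block row how far the column is from being a left inverse; a second block row exists as \<open>g \<ge> 2\<close>
  (\<open>coisometry_membership\<close>).
\<close>

section \<open>Linear algebra of finitely supported functions\<close>

definition pm_scale :: "complex \<Rightarrow> ('k \<Rightarrow>\<^sub>0 complex) \<Rightarrow> ('k \<Rightarrow>\<^sub>0 complex)" where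
  "pm_scale c p = Poly_Mapping.map ((*) c) p"

lemma lookup_pm_scale [simp]:
  "Poly_Mapping.lookup (pm_scale c p) k = c * Poly_Mapping.lookup p k"
  unfolding pm_scale_def by transfer (simp add: when_def)

lemma pm_scale_conv_mult: "pm_scale c (p :: 'k::monoid_add \<Rightarrow>\<^sub>0 complex) = Poly_Mapping.single 0 c * p"
  unfolding pm_scale_def by (rule mult_map_scale_conv_mult)

interpretation pm: vector_space "pm_scale :: complex \<Rightarrow> ('k \<Rightarrow>\<^sub>0 complex) \<Rightarrow> _"
  by standard (auto intro!: poly_mapping_eqI simp: lookup_add algebra_simps)

interpretation pmp: vector_space_pair
  "pm_scale :: complex \<Rightarrow> ('k \<Rightarrow>\<^sub>0 complex) \<Rightarrow> _"
  "pm_scale :: complex \<Rightarrow> ('l \<Rightarrow>\<^sub>0 complex) \<Rightarrow> _"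
  by standard

lemma subspace_keys_subset: "pm.subspace {p. Poly_Mapping.keys p \<subseteq> K}"
  unfolding pm.subspace_def
  by (auto simp: in_keys_iff lookup_add) (metis add_0 in_keys_iff subsetD)

lemma pm_expansion:
  assumes "finite K" "Poly_Mapping.keys p \<subseteq> K"
  shows "p = (\<Sum>k\<in>K. pm_scale (Poly_Mapping.lookup p k) (Poly_Mapping.single k 1))"
proof (rule poly_mapping_eqI)
  fix x
  have "(\<Sum>k\<in>K. Poly_Mapping.lookup p k * Poly_Mapping.lookup (Poly_Mapping.single k (1::complex)) x)
      = (\<Sum>k\<in>K. if k = x then Poly_Mapping.lookup p k else 0)"
    by (intro sum.cong) (auto simp: lookup_single)
  also have "\<dots> = Poly_Mapping.lookup p x"
    using assms by (auto simp: in_keys_iff)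
  finally show "Poly_Mapping.lookup p x =
    Poly_Mapping.lookup (\<Sum>k\<in>K. pm_scale (Poly_Mapping.lookup p k) (Poly_Mapping.single k 1)) x"
    by (simp add: lookup_sum)
qed

text \<open>
  The linear bijection between domain and range carries a basis of the one to a basis of the other. Both are
  completed to bases of the same finite-dimensional space, so equally many vectors are added on either side,
  and any bijection between the added vectors gives the extension. The injection is given as its graph,
  because in the applications it is described by congruences modulo an ideal rather than by a formula.
\<close>

lemma partial_linear_injection_extends:
  fixes R :: "('k \<Rightarrow>\<^sub>0 complex) rel"
  assumes fin: "finite K"
    and keys: "\<And>x y. (x, y) \<in> R \<Longrightarrow> Poly_Mapping.keys x \<subseteq> K \<and> Poly_Mapping.keys y \<subseteq> K"
    and zero: "(0, 0) \<in> R"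
    and add: "\<And>x y x' y'. (x, y) \<in> R \<Longrightarrow> (x', y') \<in> R \<Longrightarrow> (x + x', y + y') \<in> R"
    and scale: "\<And>c x y. (x, y) \<in> R \<Longrightarrow> (pm_scale c x, pm_scale c y) \<in> R"
    and single_valued: "\<And>y. (0, y) \<in> R \<Longrightarrow> y = 0"
    and injective: "\<And>x. (x, 0) \<in> R \<Longrightarrow> x = 0"
  obtains \<psi> \<chi> where "Vector_Spaces.linear pm_scale pm_scale \<psi>" "Vector_Spaces.linear pm_scale pm_scale \<chi>"
    "\<And>x. Poly_Mapping.keys x \<subseteq> K \<Longrightarrow> Poly_Mapping.keys (\<psi> x) \<subseteq> K"
    "\<And>x. Poly_Mapping.keys x \<subseteq> K \<Longrightarrow> Poly_Mapping.keys (\<chi> x) \<subseteq> K"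
    "\<And>x. Poly_Mapping.keys x \<subseteq> K \<Longrightarrow> \<psi> (\<chi> x) = x"
    "\<And>x. Poly_Mapping.keys x \<subseteq> K \<Longrightarrow> \<chi> (\<psi> x) = x"
    "\<And>x y. (x, y) \<in> R \<Longrightarrow> \<psi> x = y"
proof -
  let ?T = "{p :: 'k \<Rightarrow>\<^sub>0 complex. Poly_Mapping.keys p \<subseteq> K}"
  have T: "pm.subspace ?T" by (rule subspace_keys_subset)
  have T_span: "?T \<subseteq> pm.span ((\<lambda>k. Poly_Mapping.single k 1) ` K)"
  proof
    fix p assume "p \<in> ?T"
    then have "p = (\<Sum>k\<in>K. pm_scale (Poly_Mapping.lookup p k) (Poly_Mapping.single k 1))"
      using pm_expansion[OF fin] by blast
    also have "\<dots> \<in> pm.span ((\<lambda>k. Poly_Mapping.single k 1) ` K)"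
      by (intro pm.span_sum pm.span_scale pm.span_base) auto
    finally show "p \<in> pm.span ((\<lambda>k. Poly_Mapping.single k 1) ` K)" .
  qed
  have finT: "finite B" if "B \<subseteq> ?T" "pm.independent B" for B
    using pm.independent_span_bound[OF finite_imageI[OF fin] that(2) order_trans[OF that(1) T_span]]
    by simp
  obtain B where B: "B \<subseteq> Domain R" "pm.independent B" "Domain R \<subseteq> pm.span B"
    by (rule pm.maximal_independent_subset)
  have "\<forall>b\<in>B. \<exists>y. (b, y) \<in> R" using B(1) by blast
  then obtain s where s: "\<And>b. b \<in> B \<Longrightarrow> (b, s b) \<in> R" by metis
  define \<phi> where "\<phi> = pmp.construct B s"
  interpret \<phi>: Vector_Spaces.linear pm_scale pm_scale \<phi>
    unfolding \<phi>_def by (rule pmp.linear_construct[OF B(2)])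
  have R_span: "(x, \<phi> x) \<in> R" if "x \<in> pm.span B" for x
    using that
  proof (induction rule: pm.span_induct_alt)
    case (step c x y)
    have "(x, \<phi> x) \<in> R" using s[OF step(1)] step(1) by (simp add: \<phi>_def pmp.construct_basis[OF B(2)])
    then show ?case
      using add[OF scale step.IH, of x "\<phi> x" c] by (simp add: \<phi>.add \<phi>.scale)
  qed (simp add: zero)
  have sgl: "y = y'" if "(x, y) \<in> R" "(x, y') \<in> R" for x y y'
  proof -
    have "(x + pm_scale (-1) x, y + pm_scale (-1) y') \<in> R"
      by (intro add scale that)
    then have "(0, y - y') \<in> R" by (simp add: pm.scale_minus_left)
    then show ?thesis using single_valued by force
  qed
  have \<phi>: "\<phi> x = y" if "(x, y) \<in> R" for x y
    using sgl[OF R_span that] that B(3) by (meson Domain.DomainI subsetD)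
  have inj: "inj_on \<phi> (pm.span B)"
    unfolding \<phi>.inj_on_iff_eq_0[OF pm.subspace_span]
    by (metis R_span injective)
  have B_T: "B \<subseteq> ?T" using s keys by blast
  have \<phi>B_T: "\<phi> ` B \<subseteq> ?T" using R_span[OF pm.span_base] keys by blast
  have indep: "pm.independent (\<phi> ` B)"
    by (rule \<phi>.independent_injective_image[OF B(2) inj])
  obtain C where C: "B \<subseteq> C" "C \<subseteq> ?T" "pm.independent C" "?T \<subseteq> pm.span C"
    by (rule pm.maximal_independent_subset_extend[OF B_T B(2)])
  obtain D where D: "\<phi> ` B \<subseteq> D" "D \<subseteq> ?T" "pm.independent D" "?T \<subseteq> pm.span D"
    by (rule pm.maximal_independent_subset_extend[OF \<phi>B_T indep])
  have fins: "finite C" "finite D" using finT C D by auto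
  have "card C = card D"
    using pm.basis_card_eq_dim[OF C(2,4,3)] pm.basis_card_eq_dim[OF D(2,4,3)] by simp
  moreover have injB: "inj_on \<phi> B" using inj pm.span_superset inj_on_subset by blast
  ultimately have "card (C - B) = card (D - \<phi> ` B)"
    using C(1) D(1) fins by (simp add: card_Diff_subset card_image finite_subset)
  then obtain h where h: "bij_betw h (C - B) (D - \<phi> ` B)"
    using finite_same_card_bij[OF finite_Diff[OF fins(1)] finite_Diff[OF fins(2)]] by blast
  define k where "k = (\<lambda>x. if x \<in> B then \<phi> x else h x)"
  have "bij_betw k (B \<union> (C - B)) (\<phi> ` B \<union> (D - \<phi> ` B))"
  proof (rule bij_betw_combine)
    show "bij_betw k B (\<phi> ` B)" using injB by (simp add: k_def bij_betw_def inj_on_def)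
    show "bij_betw k (C - B) (D - \<phi> ` B)"
      using h by (subst bij_betw_cong[of _ _ h]) (auto simp: k_def)
  qed auto
  moreover have "B \<union> (C - B) = C" "\<phi> ` B \<union> (D - \<phi> ` B) = D" using C(1) D(1) by auto
  ultimately have k: "bij_betw k C D" by simp
  define \<psi> where "\<psi> = pmp.construct C k"
  define \<chi> where "\<chi> = pmp.construct D (inv_into C k)"
  interpret \<psi>: Vector_Spaces.linear pm_scale pm_scale \<psi>
    unfolding \<psi>_def by (rule pmp.linear_construct[OF C(3)])
  interpret \<chi>: Vector_Spaces.linear pm_scale pm_scale \<chi>
    unfolding \<chi>_def by (rule pmp.linear_construct[OF D(3)])
  have \<psi>C: "\<psi> c = k c" if "c \<in> C" for c using that by (simp add: \<psi>_def pmp.construct_basis[OF C(3)])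
  have \<chi>D: "\<chi> d = inv_into C k d" if "d \<in> D" for d using that by (simp add: \<chi>_def pmp.construct_basis[OF D(3)])
  have spC: "pm.span C = ?T" and spD: "pm.span D = ?T"
    using pm.span_subspace[OF C(2,4) T] pm.span_subspace[OF D(2,4) T] by auto
  have kC: "k ` C = D" using k by (simp add: bij_betw_def)
  have iD: "inv_into C k ` D = C" using bij_betw_inv_into[OF k] by (simp add: bij_betw_def)
  show ?thesis
  proof (rule that[of \<psi> \<chi>])
    show "Vector_Spaces.linear pm_scale pm_scale \<psi>" "Vector_Spaces.linear pm_scale pm_scale \<chi>"
      by unfold_locales
    fix x :: "'k \<Rightarrow>\<^sub>0 complex" assume x: "Poly_Mapping.keys x \<subseteq> K"
    have "\<psi> ` ?T = ?T"
      using \<psi>.span_image[of C] \<psi>C kC by (simp add: spC spD[symmetric] cong: image_cong)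
    then show "Poly_Mapping.keys (\<psi> x) \<subseteq> K" using x by blast
    have "\<chi> ` ?T = ?T"
      using \<chi>.span_image[of D] \<chi>D iD by (simp add: spD spC[symmetric] cong: image_cong)
    then show "Poly_Mapping.keys (\<chi> x) \<subseteq> K" using x by blast
    have lin: "Vector_Spaces.linear pm_scale pm_scale (\<lambda>x. \<psi> (\<chi> x))" "Vector_Spaces.linear pm_scale pm_scale (\<lambda>x. \<chi> (\<psi> x))"
      by (auto simp: Vector_Spaces.linear_iff pm.vector_space_axioms \<psi>.add \<chi>.add \<psi>.scale \<chi>.scale)
    show "\<psi> (\<chi> x) = x"
    proof (rule pmp.linear_eq_on[OF lin(1) pm.module_hom_ident[unfolded module_hom_iff_linear], of _ D])
      fix d assume "d \<in> D"
      then show "\<psi> (\<chi> d) = d"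
        using iD \<chi>D \<psi>C bij_betw_inv_into_right[OF k] by force
    qed (use x spD in auto)
    show "\<chi> (\<psi> x) = x"
    proof (rule pmp.linear_eq_on[OF lin(2) pm.module_hom_ident[unfolded module_hom_iff_linear], of _ C])
      fix c assume "c \<in> C"
      then show "\<chi> (\<psi> c) = c"
        using kC \<chi>D \<psi>C bij_betw_inv_into_left[OF k] by force
    qed (use x spC in auto)
  next
    fix x y assume "(x, y) \<in> R"
    then have "x \<in> pm.span B" and y: "y = \<phi> x" using B(3) \<phi> by auto
    have "\<psi> x = \<phi> x"
      by (rule pmp.linear_eq_on[OF \<psi>.linear_axioms \<phi>.linear_axioms \<open>x \<in> pm.span B\<close>])
        (use C(1) \<psi>C k_def in auto)
    then show "\<psi> x = y" using y by simp
  qed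
qed

text \<open>
  Finitely many coordinates of the quotient by \<open>J\<close>: coefficients of a linear projection with kernel \<open>J\<close>. On the span
  of a finite set of keys, only finitely many coordinates of the projection can be nonzero, so
  these already decide membership in \<open>J\<close>.
\<close>

lemma finite_coordinates_modulo_subspace:
  fixes J :: "('k \<Rightarrow>\<^sub>0 complex) set"
  assumes J: "pm.subspace J" and fin: "finite W"
  obtains n and \<kappa> :: "('k \<Rightarrow>\<^sub>0 complex) \<Rightarrow> nat \<Rightarrow> complex"
  where "\<And>p q i. \<kappa> (p + q) i = \<kappa> p i + \<kappa> q i"
    and "\<And>c p i. \<kappa> (pm_scale c p) i = c * \<kappa> p i"
    and "\<And>p i. p \<in> J \<Longrightarrow> \<kappa> p i = 0"
    and "\<And>p. Poly_Mapping.keys p \<subseteq> W \<Longrightarrow> (\<forall>i<n. \<kappa> p i = 0) \<Longrightarrow> p \<in> J"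
proof -
  obtain B where B: "B \<subseteq> J" "pm.independent B" "J \<subseteq> pm.span B"
    by (rule pm.maximal_independent_subset)
  obtain C where C: "B \<subseteq> C" "pm.independent C" "UNIV \<subseteq> pm.span C"
    by (rule pm.maximal_independent_subset_extend[OF subset_UNIV B(2)])
  define \<pi> where "\<pi> = pmp.construct C (\<lambda>b. if b \<in> B then 0 else b)"
  interpret \<pi>: Vector_Spaces.linear pm_scale pm_scale \<pi>
    unfolding \<pi>_def by (rule pmp.linear_construct[OF C(2)])
  have \<pi>C: "\<pi> c = (if c \<in> B then 0 else c)" if "c \<in> C" for c
    using that by (simp add: \<pi>_def pmp.construct_basis[OF C(2)])
  have \<pi>J: "\<pi> p = 0" if "p \<in> J" for p
    by (rule \<pi>.eq_0_on_span[of B]) (use B C \<pi>C that in auto)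
  have Jspan: "pm.span B = J" by (rule pm.span_subspace[OF B(1,3) J])
  have diff: "p - \<pi> p \<in> J" for p
  proof -
    have "p \<in> pm.span C" using C(3) by blast
    then show ?thesis
    proof (induction rule: pm.span_induct_alt)
      case base then show ?case using pm.subspace_0[OF J] by simp
    next
      case (step c x y)
      have "x - \<pi> x \<in> J" using step(1) \<pi>C B(1) pm.subspace_0[OF J] by auto
      then have "pm_scale c (x - \<pi> x) + (y - \<pi> y) \<in> J"
        using step.IH J by (simp add: pm.subspace_add pm.subspace_scale)
      then show ?case by (simp add: \<pi>.add \<pi>.scale pm.scale_right_diff_distrib algebra_simps)
    qed
  qed
  define V where "V = (\<Union>w\<in>W. Poly_Mapping.keys (\<pi> (Poly_Mapping.single w 1)))"
  have "finite V" using fin by (simp add: V_def)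
  then obtain e n where e: "V = e ` {..<n::nat}"
    by (metis finite_imp_nat_seg_image_inj_on lessThan_def)
  define \<kappa> where "\<kappa> = (\<lambda>p i. Poly_Mapping.lookup (\<pi> p) (e i))"
  show ?thesis
  proof (rule that[of \<kappa> n])
    fix p assume p: "Poly_Mapping.keys p \<subseteq> W" and "\<forall>i<n. \<kappa> p i = 0"
    then have 0: "Poly_Mapping.lookup (\<pi> p) v = 0" if "v \<in> V" for v
      using that unfolding e \<kappa>_def by blast
    have "\<pi> p = (\<Sum>w\<in>W. pm_scale (Poly_Mapping.lookup p w) (\<pi> (Poly_Mapping.single w 1)))"
      by (subst pm_expansion[OF fin p]) (simp add: \<pi>.sum \<pi>.scale)
    then have "Poly_Mapping.lookup (\<pi> p) v = 0" if "v \<notin> V" for v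
      using that by (auto simp: lookup_sum V_def in_keys_iff intro!: sum.neutral)
    then have "\<pi> p = 0" using 0 by (intro poly_mapping_eqI) auto
    then show "p \<in> J" using diff[of p] by simp
  qed (simp_all add: \<kappa>_def \<pi>.add \<pi>.scale \<pi>J lookup_add)
qed

section \<open>Extending partial injections to invertible matrices\<close>

text \<open>
  The matrix form of the preceding extension: vectors of length \<open>N\<close> are functions supported on \<open>{..<N}\<close>.
\<close>

lemma partial_injection_extends_to_invertible_matrix:
  fixes R :: "complex vec rel"
  assumes carrier: "\<And>x y. (x, y) \<in> R \<Longrightarrow> x \<in> carrier_vec N \<and> y \<in> carrier_vec N"
    and zero: "(0\<^sub>v N, 0\<^sub>v N) \<in> R"
    and add: "\<And>x y x' y'. (x, y) \<in> R \<Longrightarrow> (x', y') \<in> R \<Longrightarrow> (x + x', y + y') \<in> R"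
    and scale: "\<And>c x y. (x, y) \<in> R \<Longrightarrow> (c \<cdot>\<^sub>v x, c \<cdot>\<^sub>v y) \<in> R"
    and single_valued: "\<And>y. (0\<^sub>v N, y) \<in> R \<Longrightarrow> y = 0\<^sub>v N"
    and injective: "\<And>x. (x, 0\<^sub>v N) \<in> R \<Longrightarrow> x = 0\<^sub>v N"
  obtains G H where "G \<in> carrier_mat N N" "H \<in> carrier_mat N N" "G * H = 1\<^sub>m N" "H * G = 1\<^sub>m N"
    "\<And>x y. (x, y) \<in> R \<Longrightarrow> G *\<^sub>v x = y"
proof -
  define pv where "pv = (\<lambda>p :: nat \<Rightarrow>\<^sub>0 complex. vec N (Poly_Mapping.lookup p))"
  define R' where "R' = {(p, q). Poly_Mapping.keys p \<subseteq> {..<N} \<and> Poly_Mapping.keys q \<subseteq> {..<N} \<and> (pv p, pv q) \<in> R}"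
  have pv0: "pv 0 = 0\<^sub>v N" and pv_add: "pv (p + q) = pv p + pv q"
    and pv_scale: "pv (pm_scale c p) = c \<cdot>\<^sub>v pv p" for p q c
    by (auto simp: pv_def lookup_add)
  have pv_eq0: "p = 0" if "pv p = 0\<^sub>v N" "Poly_Mapping.keys p \<subseteq> {..<N}" for p
  proof (rule poly_mapping_eqI)
    fix i
    have "Poly_Mapping.lookup p i = 0" if "i < N"
      using arg_cong[OF \<open>pv p = 0\<^sub>v N\<close>, of "\<lambda>v. v $ i"] that by (simp add: pv_def)
    then show "Poly_Mapping.lookup p i = Poly_Mapping.lookup 0 i"
      using that(2) by (cases "i < N") (auto simp: in_keys_iff)
  qed
  have pv_surj: "\<exists>p. Poly_Mapping.keys p \<subseteq> {..<N} \<and> pv p = x" if "x \<in> carrier_vec N" for x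
  proof (intro exI conjI)
    let ?p = "\<Sum>i<N. pm_scale (x $ i) (Poly_Mapping.single i 1)"
    have l: "Poly_Mapping.lookup ?p j = (if j < N then x $ j else 0)" for j
    proof -
      have "Poly_Mapping.lookup ?p j = (\<Sum>i<N. if i = j then x $ i else 0)"
        unfolding lookup_sum by (intro sum.cong) (auto simp: lookup_single)
      then show ?thesis by simp
    qed
    show "Poly_Mapping.keys ?p \<subseteq> {..<N}" by (auto simp: in_keys_iff l split: if_splits)
    show "pv ?p = x" using that by (auto simp: pv_def l)
  qed
  note sub = pm.subspace_add[OF subspace_keys_subset[of "{..<N}"], simplified]
    pm.subspace_scale[OF subspace_keys_subset[of "{..<N}"], simplified]
  obtain \<psi> \<chi> where lin: "Vector_Spaces.linear pm_scale pm_scale \<psi>" "Vector_Spaces.linear pm_scale pm_scale \<chi>"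
    and k\<psi>: "\<And>x. Poly_Mapping.keys x \<subseteq> {..<N} \<Longrightarrow> Poly_Mapping.keys (\<psi> x) \<subseteq> {..<N}"
    and k\<chi>: "\<And>x. Poly_Mapping.keys x \<subseteq> {..<N} \<Longrightarrow> Poly_Mapping.keys (\<chi> x) \<subseteq> {..<N}"
    and \<psi>\<chi>: "\<And>x. Poly_Mapping.keys x \<subseteq> {..<N} \<Longrightarrow> \<psi> (\<chi> x) = x"
    and \<chi>\<psi>: "\<And>x. Poly_Mapping.keys x \<subseteq> {..<N} \<Longrightarrow> \<chi> (\<psi> x) = x"
    and R\<psi>: "\<And>x y. (x, y) \<in> R' \<Longrightarrow> \<psi> x = y"
  proof (rule partial_linear_injection_extends[of "{..<N}" R'])
    fix x y x' y' assume "(x, y) \<in> R'" "(x', y') \<in> R'"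
    then show "(x + x', y + y') \<in> R'" using sub add by (simp add: R'_def pv_add)
  next
    fix c x y assume "(x, y) \<in> R'"
    then show "(pm_scale c x, pm_scale c y) \<in> R'" using sub scale by (simp add: R'_def pv_scale)
  next
    fix y assume "(0, y) \<in> R'"
    then show "y = 0" using single_valued[of "pv y"] pv_eq0 by (simp add: R'_def pv0)
  next
    fix x assume "(x, 0) \<in> R'"
    then show "x = 0" using injective[of "pv x"] pv_eq0 by (simp add: R'_def pv0)
  qed (auto simp: R'_def pv0 zero)
  define M where "M = (\<lambda>\<phi> :: (nat \<Rightarrow>\<^sub>0 complex) \<Rightarrow> (nat \<Rightarrow>\<^sub>0 complex). mat N N (\<lambda>(i, j). Poly_Mapping.lookup (\<phi> (Poly_Mapping.single j 1)) i))"
  have M: "M \<phi> *\<^sub>v pv p = pv (\<phi> p)"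
    if "Vector_Spaces.linear pm_scale pm_scale \<phi>" "Poly_Mapping.keys p \<subseteq> {..<N}" for \<phi> p
  proof -
    interpret \<phi>: Vector_Spaces.linear pm_scale pm_scale \<phi> by fact
    have "\<phi> p = (\<Sum>j<N. pm_scale (Poly_Mapping.lookup p j) (\<phi> (Poly_Mapping.single j 1)))"
      by (subst pm_expansion[OF _ that(2)]) (simp_all add: \<phi>.sum \<phi>.scale)
    then show ?thesis
      by (intro eq_vecI)
        (simp_all add: M_def pv_def lookup_sum scalar_prod_def lessThan_atLeast0 mult.commute)
  qed
  have M1: "M \<phi> * M \<phi>' = 1\<^sub>m N"
    if "Vector_Spaces.linear pm_scale pm_scale \<phi>"
      "\<And>x. Poly_Mapping.keys x \<subseteq> {..<N} \<Longrightarrow> Poly_Mapping.keys (\<phi>' x) \<subseteq> {..<N}"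
      "\<And>x. Poly_Mapping.keys x \<subseteq> {..<N} \<Longrightarrow> \<phi> (\<phi>' x) = x" for \<phi> \<phi>'
  proof (rule eq_matI)
    fix i j assume ij: "i < dim_row (1\<^sub>m N :: complex mat)" "j < dim_col (1\<^sub>m N :: complex mat)"
    let ?e = "Poly_Mapping.single j (1::complex)"
    have e: "Poly_Mapping.keys ?e \<subseteq> {..<N}" using ij by simp
    have "col (M \<phi>') j = pv (\<phi>' ?e)" using ij by (auto simp: M_def pv_def)
    then have "(M \<phi> * M \<phi>') $$ (i, j) = (M \<phi> *\<^sub>v pv (\<phi>' ?e)) $ i" using ij by (simp add: M_def)
    also have "\<dots> = pv ?e $ i" using M[OF that(1) that(2)[OF e]] that(3)[OF e] by simp
    finally show "(M \<phi> * M \<phi>') $$ (i, j) = 1\<^sub>m N $$ (i, j)"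
      using ij by (simp add: pv_def lookup_single when_def)
  qed (auto simp: M_def)
  show ?thesis
  proof (rule that[of "M \<psi>" "M \<chi>"])
    show "M \<psi> * M \<chi> = 1\<^sub>m N" by (rule M1[OF lin(1) k\<chi> \<psi>\<chi>])
    show "M \<chi> * M \<psi> = 1\<^sub>m N" by (rule M1[OF lin(2) k\<psi> \<chi>\<psi>])
    fix x y assume xy: "(x, y) \<in> R"
    obtain p where p: "Poly_Mapping.keys p \<subseteq> {..<N}" "pv p = x" using pv_surj carrier[OF xy] by blast
    obtain q where q: "Poly_Mapping.keys q \<subseteq> {..<N}" "pv q = y" using pv_surj carrier[OF xy] by blast
    have "\<psi> p = q" using R\<psi> p q xy by (simp add: R'_def)
    then show "M \<psi> *\<^sub>v x = y" using M[OF lin(1) p(1)] p q by simp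
  qed (simp_all add: M_def)
qed

section \<open>Rational functions regular at the imaginary unit\<close>

text \<open>
  Rational functions with a denominator that does not vanish at \<open>\<i>\<close>. What the function does at the zeros of the
  denominator is left open, so that total functions such as \<open>\<lambda>z. inverse (f z)\<close> qualify.
\<close>

definition regular_at_i :: "(complex \<Rightarrow> complex) \<Rightarrow> bool" where
  "regular_at_i h \<longleftrightarrow> (\<exists>p q. poly q \<i> \<noteq> 0 \<and> (\<forall>z. poly q z \<noteq> 0 \<longrightarrow> h z = poly p z / poly q z))"

lemma regular_const: "regular_at_i (\<lambda>z. c)"
  unfolding regular_at_i_def by (intro exI[of _ "[:c:]"] exI[of _ 1]) simp

lemma regular_ident: "regular_at_i (\<lambda>z. z)"
  unfolding regular_at_i_def by (intro exI[of _ "[:0, 1:]"] exI[of _ 1]) simp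

lemma regular_add:
  assumes "regular_at_i f" "regular_at_i h"
  shows "regular_at_i (\<lambda>z. f z + h z)"
proof -
  obtain p q where f: "poly q \<i> \<noteq> 0" "\<And>z. poly q z \<noteq> 0 \<Longrightarrow> f z = poly p z / poly q z"
    using assms(1) unfolding regular_at_i_def by blast
  obtain p' q' where h: "poly q' \<i> \<noteq> 0" "\<And>z. poly q' z \<noteq> 0 \<Longrightarrow> h z = poly p' z / poly q' z"
    using assms(2) unfolding regular_at_i_def by blast
  show ?thesis
    unfolding regular_at_i_def
    by (intro exI[of _ "p * q' + p' * q"] exI[of _ "q * q'"]) (simp add: f h add_frac_eq)
qed

lemma regular_mult:
  assumes "regular_at_i f" "regular_at_i h"
  shows "regular_at_i (\<lambda>z. f z * h z)"
proof -
  obtain p q where f: "poly q \<i> \<noteq> 0" "\<And>z. poly q z \<noteq> 0 \<Longrightarrow> f z = poly p z / poly q z"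
    using assms(1) unfolding regular_at_i_def by blast
  obtain p' q' where h: "poly q' \<i> \<noteq> 0" "\<And>z. poly q' z \<noteq> 0 \<Longrightarrow> h z = poly p' z / poly q' z"
    using assms(2) unfolding regular_at_i_def by blast
  show ?thesis
    unfolding regular_at_i_def
    by (intro exI[of _ "p * p'"] exI[of _ "q * q'"]) (simp add: f h)
qed

lemma regular_inverse:
  assumes "regular_at_i f" "f \<i> \<noteq> 0"
  shows "regular_at_i (\<lambda>z. inverse (f z))"
proof -
  obtain p q where f: "poly q \<i> \<noteq> 0" "\<And>z. poly q z \<noteq> 0 \<Longrightarrow> f z = poly p z / poly q z"
    using assms(1) unfolding regular_at_i_def by blast
  show ?thesis
    unfolding regular_at_i_def
    by (intro exI[of _ "q * q"] exI[of _ "p * q"]) (use f assms(2) in auto)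
qed

lemma regular_sum: "(\<And>x. x \<in> S \<Longrightarrow> regular_at_i (f x)) \<Longrightarrow> regular_at_i (\<lambda>z. \<Sum>x\<in>S. f x z)"
  by (induction S rule: infinite_finite_induct) (simp_all add: regular_const regular_add)

lemma regular_prod: "(\<And>x. x \<in> S \<Longrightarrow> regular_at_i (f x)) \<Longrightarrow> regular_at_i (\<lambda>z. \<Prod>x\<in>S. f x z)"
  by (induction S rule: infinite_finite_induct) (simp_all add: regular_const regular_mult)

text \<open>
  The identity principle in the only form used below: a value at \<open>\<i>\<close> is controlled by the values at almost all
  real parameters.
\<close>

lemma regular_finite_zeros:
  assumes "regular_at_i h" "h \<i> \<noteq> 0"
  shows "finite {t :: real. h (of_real t) = 0}"
proof -
  obtain p q where f: "poly q \<i> \<noteq> 0" "\<And>z. poly q z \<noteq> 0 \<Longrightarrow> h z = poly p z / poly q z"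
    using assms(1) unfolding regular_at_i_def by blast
  have "p \<noteq> 0" "q \<noteq> 0" using f assms(2) by auto
  then have "finite ({z. poly p z = 0} \<union> {z. poly q z = 0})" by (simp add: poly_roots_finite)
  then have "finite (of_real -` ({z. poly p z = 0} \<union> {z. poly q z = 0}) :: real set)"
    by (rule finite_vimageI) (simp add: inj_def)
  then show ?thesis by (rule finite_subset[rotated]) (use f(2) in force)
qed

definition regular_mat :: "nat \<Rightarrow> (complex \<Rightarrow> complex mat) \<Rightarrow> bool" where
  "regular_mat N F \<longleftrightarrow>
     (\<forall>z. F z \<in> carrier_mat N N) \<and> (\<forall>i<N. \<forall>j<N. regular_at_i (\<lambda>z. F z $$ (i, j)))"

lemma regular_mat_mult:
  assumes "regular_mat N F" "regular_mat N F'"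
  shows "regular_mat N (\<lambda>z. F z * F' z)"
  unfolding regular_mat_def
proof (intro conjI allI impI)
  have c: "F z \<in> carrier_mat N N" "F' z \<in> carrier_mat N N" for z
    using assms by (auto simp: regular_mat_def)
  then show "F z * F' z \<in> carrier_mat N N" for z by (rule mult_carrier_mat)
  have d: "dim_row (F z) = N" "dim_col (F z) = N" "dim_row (F' z) = N" "dim_col (F' z) = N" for z
    using c[of z] by auto
  fix i j assume "i < N" "j < N"
  then show "regular_at_i (\<lambda>z. (F z * F' z) $$ (i, j))"
    using assms
    by (simp add: d scalar_prod_def) (intro regular_sum regular_mult; simp add: regular_mat_def)
qed

lemma regular_det:
  assumes "regular_mat N F"
  shows "regular_at_i (\<lambda>z. det (F z))"
proof -
  have c: "F z \<in> carrier_mat N N" for z using assms by (auto simp: regular_mat_def)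
  have "regular_at_i (\<lambda>z. \<Sum>p\<in>{p. p permutes {0..<N}}. signof p * (\<Prod>i = 0..<N. F z $$ (i, p i)))"
    using assms
    by (intro regular_sum regular_mult regular_prod regular_const)
      (auto simp: regular_mat_def permutes_in_image)
  then show ?thesis by (simp add: det_def'[OF c])
qed

text \<open>
  Cramer's formula, chosen since it exhibits the entries of the inverse as rational functions.
\<close>

definition inv_mat :: "complex mat \<Rightarrow> complex mat" where
  "inv_mat A = inverse (det A) \<cdot>\<^sub>m adj_mat A"

lemma inv_mat_carrier: "A \<in> carrier_mat N N \<Longrightarrow> inv_mat A \<in> carrier_mat N N"
  by (simp add: inv_mat_def adj_mat(1))

lemma inv_mat_right:
  assumes "A \<in> carrier_mat N N" "det A \<noteq> 0"
  shows "A * inv_mat A = 1\<^sub>m N"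
proof -
  have "A * inv_mat A = inverse (det A) \<cdot>\<^sub>m (det A \<cdot>\<^sub>m 1\<^sub>m N)"
    unfolding inv_mat_def by (simp add: mult_smult_distrib[OF assms(1) adj_mat(1)[OF assms(1)]] adj_mat(2)[OF assms(1)])
  then show ?thesis using assms(2) by (auto intro!: eq_matI)
qed

lemma inv_mat_left:
  assumes "A \<in> carrier_mat N N" "det A \<noteq> 0"
  shows "inv_mat A * A = 1\<^sub>m N"
  by (rule mat_mult_left_right_inverse[OF assms(1) inv_mat_carrier[OF assms(1)] inv_mat_right[OF assms]])

lemma regular_inv_mat:
  assumes F: "regular_mat N F" and "det (F \<i>) \<noteq> 0"
  shows "regular_mat N (\<lambda>z. inv_mat (F z))"
  unfolding regular_mat_def
proof (intro conjI allI impI)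
  have c: "F z \<in> carrier_mat N N" for z using F by (auto simp: regular_mat_def)
  then show "inv_mat (F z) \<in> carrier_mat N N" for z by (rule inv_mat_carrier)
  have d: "dim_row (F z) = N" "dim_col (F z) = N" for z using c[of z] by auto
  fix i j assume ij: "i < N" "j < N"
  have "regular_mat (N - 1) (\<lambda>z. mat_delete (F z) j i)"
    unfolding regular_mat_def
  proof (intro conjI allI impI)
    show "mat_delete (F z) j i \<in> carrier_mat (N - 1) (N - 1)" for z
      using mat_delete_carrier[OF c] .
    fix a b assume "a < N - 1" "b < N - 1"
    then show "regular_at_i (\<lambda>z. mat_delete (F z) j i $$ (a, b))"
      using F by (auto simp: mat_delete_def d regular_mat_def)
  qed
  then have "regular_at_i (\<lambda>z. (-1) ^ (j + i) * det (mat_delete (F z) j i))"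
    by (intro regular_mult regular_const regular_det)
  moreover have "regular_at_i (\<lambda>z. inverse (det (F z)))"
    by (intro regular_inverse regular_det[OF F] assms(2))
  ultimately show "regular_at_i (\<lambda>z. inv_mat (F z) $$ (i, j))"
    unfolding inv_mat_def using ij
    by (simp add: adj_mat_def d cofactor_def regular_mult)
qed

lemma adjoint_entry:
  "i < dim_col A \<Longrightarrow> j < dim_row A \<Longrightarrow> mat_adjoint A $$ (i, j) = cnj (A $$ (j, i))"
  by (simp add: mat_adjoint_def mat_of_rows_def)

lemma adjoint_dims [simp]:
  "dim_row (mat_adjoint A) = dim_col A" "dim_col (mat_adjoint A) = dim_row A"
  by (simp_all add: mat_adjoint_def)

lemma adjoint_mult:
  fixes A B :: "complex mat"
  assumes "A \<in> carrier_mat n m" "B \<in> carrier_mat m k"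
  shows "mat_adjoint (A * B) = mat_adjoint B * mat_adjoint A"
proof (rule eq_matI)
  fix i j
  assume "i < dim_row (mat_adjoint B * mat_adjoint A)" "j < dim_col (mat_adjoint B * mat_adjoint A)"
  then have ij: "i < k" "j < n" using assms by auto
  have "mat_adjoint (A * B) $$ (i, j) = (\<Sum>l = 0..<m. cnj (A $$ (j, l)) * cnj (B $$ (l, i)))"
    using ij assms by (simp add: adjoint_entry scalar_prod_def)
  also have "\<dots> = (mat_adjoint B * mat_adjoint A) $$ (i, j)"
    using ij assms by (simp add: adjoint_entry scalar_prod_def mult.commute)
  finally show "mat_adjoint (A * B) $$ (i, j) = (mat_adjoint B * mat_adjoint A) $$ (i, j)" .
qed (use assms in auto)

lemma adjoint_carrier: "A \<in> carrier_mat n m \<Longrightarrow> mat_adjoint A \<in> carrier_mat m n"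
  using adjoint_dims by blast

lemma adjoint_one: "mat_adjoint (1\<^sub>m n :: complex mat) = 1\<^sub>m n"
  by (intro eq_matI) (auto simp: adjoint_entry)

section \<open>Unitary rational paths through invertible matrices\<close>

lemma one_minus_one_plus_commute:
  fixes T :: "'a :: ring_1 mat"
  assumes T: "T \<in> carrier_mat n n"
  shows "(1\<^sub>m n - T) * (1\<^sub>m n + T) = (1\<^sub>m n + T) * (1\<^sub>m n - T)"
proof -
  have c: "1\<^sub>m n + T \<in> carrier_mat n n" "1\<^sub>m n - T \<in> carrier_mat n n" "T * T \<in> carrier_mat n n"
    using T by (simp_all add: minus_carrier_mat mult_carrier_mat[OF T T])
  have "(1\<^sub>m n - T) * (1\<^sub>m n + T) = 1\<^sub>m n + T - (T + T * T)"
    using c T by (simp add: minus_mult_distrib_mat[OF one_carrier_mat T c(1)] mult_add_distrib_mat[OF T one_carrier_mat T])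
  moreover have "(1\<^sub>m n + T) * (1\<^sub>m n - T) = 1\<^sub>m n - T + (T - T * T)"
    using c T by (simp add: add_mult_distrib_mat[OF one_carrier_mat T c(2)] mult_minus_distrib_mat[OF T one_carrier_mat T])
  moreover have "1\<^sub>m n + T - (T + T * T) = 1\<^sub>m n - T + (T - T * T)"
    using c(3) T by (intro eq_matI) (simp_all del: index_mult_mat(1))
  ultimately show ?thesis by simp
qed

lemma mult_mat_reassoc4:
  fixes A :: "'a :: semiring_1 mat"
  assumes A: "A \<in> carrier_mat n n" and B: "B \<in> carrier_mat n n"
    and C: "C \<in> carrier_mat n n" and D: "D \<in> carrier_mat n n"
  shows "(A * B) * (C * D) = A * ((B * C) * D)"
  by (simp only: assoc_mult_mat[OF A B mult_carrier_mat[OF C D]] assoc_mult_mat[OF B C D])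

text \<open>
  If \<open>S\<close> is skew-Hermitian then \<open>(1 + S) (1 - S)\<^sup>-\<^sup>1\<close> is unitary. Any matrix \<open>S\<close> is the value at \<open>\<i>\<close> of a pencil
  \<open>T z = S\<^sub>1 + z S\<^sub>2\<close> with \<open>S\<^sub>1\<close> and \<open>S\<^sub>2\<close> skew-Hermitian, hence skew-Hermitian at real \<open>z\<close>. So the Cayley transform of
  the pencil is unitary at real parameters, and it remains to write \<open>G\<close> as a Cayley transform. That fails
  if \<open>-1\<close> is an eigenvalue of \<open>G\<close>; therefore \<open>G\<close> is rotated by a unimodular number \<open>w\<close> outside its
  spectrum, that is \<open>G = - w (1 + S) (1 - S)\<^sup>-\<^sup>1\<close>.
\<close>

lemma unitary_rational_path:
  assumes G: "G \<in> carrier_mat N N" and H: "H \<in> carrier_mat N N" and GH: "G * H = 1\<^sub>m N"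
  obtains P Q where "regular_mat N P" "regular_mat N Q" "P \<i> = G" "Q \<i> = H"
    "finite {t :: real. \<not> (unitary_mat N (P (of_real t)) \<and> Q (of_real t) = mat_adjoint (P (of_real t)))}"
proof -
  have detG: "det G \<noteq> 0" using det_mult[OF G H] GH by auto
  have "char_poly G \<noteq> 0" using degree_monic_char_poly[OF G] by auto
  then have "finite {w. poly (char_poly G) w = 0}" by (rule poly_roots_finite)
  \<comment> \<open>An arc of the unit circle is infinite, so it contains a number that is not an eigenvalue.\<close>
  moreover have "infinite (cis ` {0<..<1})"
  proof -
    have "inj_on cis {0<..<1}"
    proof (rule inj_onI)
      fix x y :: real assume "x \<in> {0<..<1}" "y \<in> {0<..<1}" "cis x = cis y"
      then have "cos x = cos y" "0 \<le> x" "x \<le> pi" "0 \<le> y" "y \<le> pi"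
        using pi_ge_two by (auto simp: complex_eq_iff)
      then show "x = y" using cos_inj_pi by blast
    qed
    then show ?thesis by (simp add: finite_image_iff infinite_Ioo)
  qed
  ultimately have "\<not> cis ` {0<..<1} \<subseteq> {w. poly (char_poly G) w = 0}"
    using finite_subset by blast
  then obtain x where x: "poly (char_poly G) (cis x) \<noteq> 0" by blast
  define w where "w = cis x"
  have w1: "w * cnj w = 1" by (simp add: w_def cis_cnj cis_mult)
  have "\<not> eigenvalue G w" using x eigenvalue_root_char_poly[OF G] by (simp add: w_def)
  then have det_w: "det (char_matrix G w) \<noteq> 0" using eigenvalue_det[OF G] by blast
  have w0: "w \<noteq> 0" using w1 by auto
  let ?C = "char_matrix G w"
  have C: "?C \<in> carrier_mat N N" using G by simp
  \<comment> \<open>Solving \<open>G = - w (1 + S) (1 - S)\<^sup>-\<^sup>1\<close> for \<open>1 - S\<close> gives \<open>Z = - 2 w (G - w)\<^sup>-\<^sup>1\<close>.\<close>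
  define Z where "Z = (- 2 * w) \<cdot>\<^sub>m inv_mat ?C"
  have Z: "Z \<in> carrier_mat N N" using inv_mat_carrier[OF C] by (simp add: Z_def)
  have CZ: "?C * Z = (- 2 * w) \<cdot>\<^sub>m 1\<^sub>m N"
    unfolding Z_def by (simp only: mult_smult_distrib[OF C inv_mat_carrier[OF C]] inv_mat_right[OF C det_w])
  have detZ: "det Z \<noteq> 0"
  proof
    assume "det Z = 0"
    then have "det ((- 2 * w) \<cdot>\<^sub>m 1\<^sub>m N) = (0::complex)" using det_mult[OF C Z] CZ by simp
    then show False using w0 by simp
  qed
  define S where "S = 1\<^sub>m N - Z"
  define T where "T = (\<lambda>z. mat N N (\<lambda>(i, j). (S $$ (i, j) - cnj (S $$ (j, i))) / 2
                                 + z * ((S $$ (i, j) + cnj (S $$ (j, i))) / (2 * \<i>))))"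
  define M where "M = (\<lambda>z. 1\<^sub>m N - T z)"
  define L where "L = (\<lambda>z. (- w) \<cdot>\<^sub>m (1\<^sub>m N + T z))"
  define P where "P = (\<lambda>z. L z * inv_mat (M z))"
  define Q where "Q = (\<lambda>z. inv_mat (P z))"
  have S: "S \<in> carrier_mat N N" using Z by (auto simp: S_def)
  have T: "T z \<in> carrier_mat N N" for z by (simp add: T_def)
  have M: "M z \<in> carrier_mat N N" for z using T[of z] by (auto simp: M_def)
  have L: "L z \<in> carrier_mat N N" for z using T[of z] by (auto simp: L_def)
  have P: "P z \<in> carrier_mat N N" for z
    unfolding P_def by (rule mult_carrier_mat[OF L inv_mat_carrier[OF M]])
  have regT: "regular_at_i (\<lambda>z. T z $$ (i, j))" if "i < N" "j < N" for i j
  proof -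
    have "T z $$ (i, j) = (S $$ (i, j) - cnj (S $$ (j, i))) / 2
        + z * ((S $$ (i, j) + cnj (S $$ (j, i))) / (2 * \<i>))" for z
      unfolding T_def using that by (subst index_mat) auto
    then show ?thesis by (simp only:) (intro regular_add regular_mult regular_const regular_ident)
  qed
  have regM: "regular_mat N M"
    unfolding regular_mat_def
  proof (intro conjI allI impI)
    fix i j assume ij: "i < N" "j < N"
    have "regular_at_i (\<lambda>z. 1\<^sub>m N $$ (i, j) + (-1) * T z $$ (i, j))"
      by (intro regular_add regular_mult regular_const regT ij)
    moreover have "M z $$ (i, j) = 1\<^sub>m N $$ (i, j) + (-1) * T z $$ (i, j)" for z
      using ij T[of z] unfolding M_def by (subst index_minus_mat) auto
    ultimately show "regular_at_i (\<lambda>z. M z $$ (i, j))" by (simp only:)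
  qed (rule M)
  have regL: "regular_mat N L"
    unfolding regular_mat_def
  proof (intro conjI allI impI)
    fix i j assume ij: "i < N" "j < N"
    have "regular_at_i (\<lambda>z. (- w) * (1\<^sub>m N $$ (i, j) + T z $$ (i, j)))"
      by (intro regular_add regular_mult regular_const regT ij)
    moreover have "L z $$ (i, j) = (- w) * (1\<^sub>m N $$ (i, j) + T z $$ (i, j))" for z
      using ij T[of z] unfolding L_def by (subst index_smult_mat) auto
    ultimately show "regular_at_i (\<lambda>z. L z $$ (i, j))" by (simp only:)
  qed (rule L)
  have Ti: "T \<i> = S"
    using S by (intro eq_matI) (auto simp: T_def field_simps)
  have Mi: "M \<i> = Z" using Z by (auto simp: M_def Ti S_def intro!: eq_matI)
  have Li: "L \<i> = G * Z"
  proof -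
    have "G = ?C + w \<cdot>\<^sub>m 1\<^sub>m N" using G by (auto simp: char_matrix_def intro!: eq_matI)
    then have "G * Z = ?C * Z + (w \<cdot>\<^sub>m 1\<^sub>m N) * Z"
      using add_mult_distrib_mat[OF C _ Z, of "w \<cdot>\<^sub>m 1\<^sub>m N"] by simp
    also have "(w \<cdot>\<^sub>m 1\<^sub>m N) * Z = w \<cdot>\<^sub>m Z"
      using Z by (simp add: mult_smult_assoc_mat[OF one_carrier_mat Z])
    finally show ?thesis
      unfolding CZ L_def Ti S_def using Z by (auto intro!: eq_matI simp: algebra_simps)
  qed
  have Pi: "P \<i> = G"
    unfolding P_def Mi Li
    using assoc_mult_mat[OF G Z inv_mat_carrier[OF Z]] inv_mat_right[OF Z detZ] G by simp
  have regP: "regular_mat N P"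
    unfolding P_def by (rule regular_mat_mult[OF regL regular_inv_mat[OF regM]]) (simp add: Mi detZ)
  have regQ: "regular_mat N Q"
    unfolding Q_def by (rule regular_inv_mat[OF regP]) (simp add: Pi detG)
  have Qi: "Q \<i> = H"
  proof -
    have "Q \<i> = inv_mat G * (G * H)"
      using inv_mat_carrier[OF G] by (simp add: Q_def Pi GH)
    also have "\<dots> = (inv_mat G * G) * H" by (rule assoc_mult_mat[symmetric, OF inv_mat_carrier[OF G] G H])
    also have "\<dots> = H" using H by (simp add: inv_mat_left[OF G detG])
    finally show ?thesis .
  qed
  \<comment> \<open>As \<open>L\<^sup>* L = M\<^sup>* M\<close> at real parameters, \<open>L M\<^sup>-\<^sup>1\<close> is an isometry wherever \<open>M\<close> is invertible.\<close>
  have unit: "unitary_mat N (P (of_real t)) \<and> Q (of_real t) = mat_adjoint (P (of_real t))"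
    if t: "det (M (of_real t)) \<noteq> 0" for t :: real
  proof -
    let ?t = "complex_of_real t"
    let ?A = "mat_adjoint (P ?t)" and ?K = "inv_mat (M ?t)"
    note aM = adjoint_carrier[OF M[of ?t]] and aL = adjoint_carrier[OF L[of ?t]]
      and K = inv_mat_carrier[OF M[of ?t]]
    note aK = adjoint_carrier[OF K]
    have A: "?A \<in> carrier_mat N N" by (rule adjoint_carrier[OF P])
    have M': "mat_adjoint (M ?t) = 1\<^sub>m N + T ?t"
      by (intro eq_matI) (auto simp: adjoint_entry M_def T_def field_simps)
    have L': "mat_adjoint (L ?t) = (- cnj w) \<cdot>\<^sub>m M ?t"
      by (intro eq_matI) (auto simp: adjoint_entry M_def L_def T_def field_simps)
    have "mat_adjoint (L ?t) * L ?t = (- cnj w * - w) \<cdot>\<^sub>m (M ?t * (1\<^sub>m N + T ?t))"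
      unfolding L' unfolding L_def using M[of ?t] T[of ?t]
      by (subst mult_smult_assoc_mat[of _ N N _ N]) (auto simp: mult_smult_distrib[of _ N N _ N] intro!: eq_matI)
    also have "- cnj w * - w = 1" using w1 by (simp add: mult.commute)
    also have "1 \<cdot>\<^sub>m (M ?t * (1\<^sub>m N + T ?t)) = (1\<^sub>m N - T ?t) * (1\<^sub>m N + T ?t)"
      by (auto simp: M_def)
    also have "\<dots> = (1\<^sub>m N + T ?t) * (1\<^sub>m N - T ?t)"
      by (rule one_minus_one_plus_commute[OF T])
    finally have LL: "mat_adjoint (L ?t) * L ?t = mat_adjoint (M ?t) * M ?t"
      by (simp add: M') (simp add: M_def)
    have MK: "M ?t * ?K = 1\<^sub>m N" by (rule inv_mat_right[OF M t])
    have "?A * P ?t = mat_adjoint ?K * ((mat_adjoint (L ?t) * L ?t) * ?K)"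
      unfolding P_def adjoint_mult[OF L K] by (rule mult_mat_reassoc4[OF aK aL L K])
    also have "\<dots> = (mat_adjoint ?K * mat_adjoint (M ?t)) * (M ?t * ?K)"
      unfolding LL by (rule mult_mat_reassoc4[OF aK aM M K, symmetric])
    also have "\<dots> = mat_adjoint (M ?t * ?K) * (M ?t * ?K)" by (simp add: adjoint_mult[OF M K])
    also have "\<dots> = 1\<^sub>m N" unfolding MK by (simp add: adjoint_one)
    finally have AP: "?A * P ?t = 1\<^sub>m N" .
    have PA: "P ?t * ?A = 1\<^sub>m N" by (rule mat_mult_left_right_inverse[OF A P AP])
    have detP: "det (P ?t) \<noteq> 0" using det_mult[OF A P[of ?t]] AP by auto
    note PI = inv_mat_carrier[OF P[of ?t]]
    have "Q ?t = (?A * P ?t) * inv_mat (P ?t)"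
      unfolding AP Q_def using left_mult_one_mat[OF PI] by simp
    also have "\<dots> = ?A * (P ?t * inv_mat (P ?t))" by (rule assoc_mult_mat[OF A P PI])
    also have "\<dots> = ?A" unfolding inv_mat_right[OF P detP] by (rule right_mult_one_mat[OF A])
    finally show ?thesis using P[of ?t] PA AP by (simp add: unitary_mat_def)
  qed
  have "finite {t :: real. det (M (of_real t)) = 0}"
    by (rule regular_finite_zeros[OF regular_det[OF regM]]) (simp add: Mi detZ)
  then have fin: "finite {t :: real. \<not> (unitary_mat N (P (of_real t)) \<and> Q (of_real t) = mat_adjoint (P (of_real t)))}"
    by (rule finite_subset[rotated]) (use unit in blast)
  show ?thesis by (rule that[OF regP regQ Pi Qi fin])
qed

section \<open>Evaluation at blocks of matrices\<close>

definition word_prod :: "nat \<Rightarrow> ('i letter \<Rightarrow> complex mat) \<Rightarrow> 'i letter list \<Rightarrow> complex mat" where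
  "word_prod n L w = foldr (\<lambda>l M. L l * M) w (1\<^sub>m n)"

lemma word_prod_simps [simp]:
  "word_prod n L [] = 1\<^sub>m n" "word_prod n L (l # w) = L l * word_prod n L w"
  by (simp_all add: word_prod_def)

lemma word_eval_conv_word_prod: "word_eval n A w = word_prod n (letter_eval A) w"
  by (simp add: word_eval_def word_prod_def)

lemma word_prod_carrier:
  "(\<And>l. l \<in> set w \<Longrightarrow> L l \<in> carrier_mat n n) \<Longrightarrow> word_prod n L w \<in> carrier_mat n n"
proof (induction w)
  case (Cons l w)
  have "L l \<in> carrier_mat n n" "word_prod n L w \<in> carrier_mat n n" using Cons by simp_all
  then show ?case by (simp add: mult_carrier_mat[of _ n n _ n])
qed simp

lemma word_prod_cong:
  "(\<And>l. l \<in> set w \<Longrightarrow> L l = L' l) \<Longrightarrow> word_prod n L w = word_prod n L' w"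
  by (induction w) simp_all

lemma finsum_ring_mat:
  fixes F :: "'b \<Rightarrow> complex mat"
  assumes "finite S" "\<And>x. x \<in> S \<Longrightarrow> F x \<in> carrier_mat n n"
  shows "(\<Oplus>\<^bsub>ring_mat TYPE(complex) n ()\<^esub>x\<in>S. F x) = mat n n (\<lambda>(i, j). \<Sum>x\<in>S. F x $$ (i, j))"
proof -
  interpret R: ring "ring_mat TYPE(complex) n ()" by (rule ring_mat)
  show ?thesis
    using assms
  proof (induction S rule: finite_induct)
    case empty
    show ?case by (auto simp: ring_mat_simps intro!: eq_matI)
  next
    case (insert x S)
    have "(\<Oplus>\<^bsub>ring_mat TYPE(complex) n ()\<^esub>y\<in>insert x S. F y)
        = F x + (\<Oplus>\<^bsub>ring_mat TYPE(complex) n ()\<^esub>y\<in>S. F y)"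
      using insert by (subst R.finsum_insert) (auto simp: ring_mat_simps)
    also have "(\<Oplus>\<^bsub>ring_mat TYPE(complex) n ()\<^esub>y\<in>S. F y) = mat n n (\<lambda>(i, j). \<Sum>y\<in>S. F y $$ (i, j))"
      by (rule insert.IH) (simp add: insert.prems)
    finally show ?case
      using insert.hyps insert.prems[of x] by (simp only: mat_eq_iff) auto
  qed
qed

lemma star_eval_entry:
  assumes "\<And>w. w \<in> Poly_Mapping.keys f \<Longrightarrow> word_eval n A w \<in> carrier_mat n n" "a < n" "b < n"
  shows "star_eval n A f $$ (a, b)
       = (\<Sum>w\<in>Poly_Mapping.keys f. Poly_Mapping.lookup f w * word_eval n A w $$ (a, b))"
proof -
  have d: "dim_row (word_eval n A w) = n" "dim_col (word_eval n A w) = n" if "w \<in> Poly_Mapping.keys f" for w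
    using assms(1)[OF that] by auto
  show ?thesis
    unfolding star_eval_def
    by (subst finsum_ring_mat) (use assms d in \<open>simp_all add: smult_carrier_mat\<close>)
qed

definition block :: "nat \<Rightarrow> nat \<Rightarrow> nat \<Rightarrow> complex mat \<Rightarrow> complex mat" where
  "block n r c U = mat n n (\<lambda>(a, b). U $$ (r * n + a, c * n + b))"

lemma block_carrier [simp]: "block n r c U \<in> carrier_mat n n"
  by (simp add: block_def)

lemma block_index_less: "r < s \<Longrightarrow> a < n \<Longrightarrow> r * n + a < s * (n::nat)"
  using mult_le_mono1[of "Suc r" s n] by simp

lemma regular_mat_block:
  assumes "regular_mat (s * n) F" "r < s" "c < s"
  shows "regular_mat n (\<lambda>z. block n r c (F z))"
  using assms by (simp add: regular_mat_def block_def block_index_less)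

lemma adjoint_block:
  assumes "U \<in> carrier_mat (s * n) (s * n)" "r < s" "c < s"
  shows "mat_adjoint (block n r c U) = block n c r (mat_adjoint U)"
  using assms by (intro eq_matI) (simp_all add: block_def adjoint_entry block_index_less)

text \<open>
  A common frame for the three kinds of relations: the letter with index \<open>i\<close> stands for the block in position
  \<open>(row_of i, col_of i)\<close> of the \<open>s \<times> s\<close> block matrix with label \<open>mat_of i\<close>.
\<close>

locale block_indexed_letters =
  fixes I :: "'i set" and K :: "'k set" and s :: nat
    and mat_of :: "'i \<Rightarrow> 'k" and row_of col_of :: "'i \<Rightarrow> nat"
  assumes finite_K: "finite K"
    and mat_of: "i \<in> I \<Longrightarrow> mat_of i \<in> K"
    and row_of: "i \<in> I \<Longrightarrow> row_of i < s"
    and col_of: "i \<in> I \<Longrightarrow> col_of i < s"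
begin

definition blocks :: "nat \<Rightarrow> ('k \<Rightarrow> complex mat) \<Rightarrow> 'i \<Rightarrow> complex mat" where
  "blocks n U i = block n (row_of i) (col_of i) (U (mat_of i))"

text \<open>
  The evaluation without adjoints: \<open>H\<close> takes the part of the adjoint of \<open>G\<close>. Row and column are exchanged for the
  letters \<open>Adj i\<close>, since a block of an adjoint matrix is the adjoint of the transposed block.
\<close>

definition pair_letter :: "nat \<Rightarrow> ('k \<Rightarrow> complex mat) \<Rightarrow> ('k \<Rightarrow> complex mat) \<Rightarrow> 'i letter \<Rightarrow> complex mat" where
  "pair_letter n G H l = (case l of
     Var i \<Rightarrow> block n (row_of i) (col_of i) (G (mat_of i))
   | Adj i \<Rightarrow> block n (col_of i) (row_of i) (H (mat_of i)))"

lemma pair_letter_carrier [simp]: "pair_letter n G H l \<in> carrier_mat n n"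
  by (simp add: pair_letter_def split: letter.split)

text \<open>
  Each entry of the evaluation is a rational function along the paths through the \<open>G k\<close>. At almost all real
  parameters the matrices are unitary and the partner is the adjoint, so the entry vanishes there, and
  therefore also at \<open>\<i>\<close>, where the pair is \<open>(G k, H k)\<close>. One real parameter serves all \<open>k\<close> at once, since each
  path excludes only finitely many.
\<close>

lemma vanishing_extends_to_inverse_pairs:
  assumes f: "f \<in> carrier (free_star_algebra I)"
    and GH: "\<And>k. k \<in> K \<Longrightarrow> G k \<in> carrier_mat (s * n) (s * n)" "\<And>k. k \<in> K \<Longrightarrow> H k \<in> carrier_mat (s * n) (s * n)"
      "\<And>k. k \<in> K \<Longrightarrow> G k * H k = 1\<^sub>m (s * n)"
    and vanish: "\<And>U. (\<And>k. k \<in> K \<Longrightarrow> unitary_mat (s * n) (U k)) \<Longrightarrow> star_eval n (blocks n U) f = 0\<^sub>m n n"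
    and ab: "a < n" "b < n"
  shows "(\<Sum>w\<in>Poly_Mapping.keys f. Poly_Mapping.lookup f w * word_prod n (pair_letter n G H) w $$ (a, b)) = 0"
proof (rule ccontr)
  define unitary_path where "unitary_path = (\<lambda>k P Q. regular_mat (s * n) P \<and> regular_mat (s * n) Q \<and> P \<i> = G k \<and> Q \<i> = H k \<and>
    finite {t :: real. \<not> (unitary_mat (s * n) (P (of_real t)) \<and> Q (of_real t) = mat_adjoint (P (of_real t)))})"
  have "\<exists>P Q. unitary_path k P Q" if "k \<in> K" for k
    unfolding unitary_path_def by (rule unitary_rational_path[OF GH[OF that]]) blast
  then obtain P Q where unitary_path: "unitary_path k (P k) (Q k)" if "k \<in> K" for k by metis
  then have PQ: "regular_mat (s * n) (P k)" "regular_mat (s * n) (Q k)" "P k \<i> = G k" "Q k \<i> = H k"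
    and fin: "finite {t :: real. \<not> (unitary_mat (s * n) (P k (of_real t)) \<and> Q k (of_real t) = mat_adjoint (P k (of_real t)))}"
    if "k \<in> K" for k
    using that unfolding unitary_path_def by simp_all
  define L where "L = (\<lambda>z. pair_letter n (\<lambda>k. P k z) (\<lambda>k. Q k z))"
  have fI: "letter_index l \<in> I" if "w \<in> Poly_Mapping.keys f" "l \<in> set w" for w l
    using f that by (auto simp: free_star_algebra_def)
  have regL: "regular_mat n (\<lambda>z. L z l)" if "letter_index l \<in> I" for l
    using that mat_of row_of col_of PQ
    by (cases l) (auto simp: L_def pair_letter_def intro!: regular_mat_block[where s = s])
  have regw: "regular_mat n (\<lambda>z. word_prod n (L z) w)" if "\<And>l. l \<in> set w \<Longrightarrow> letter_index l \<in> I" for w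
    using that
  proof (induction w)
    case Nil
    then show ?case by (simp add: regular_mat_def regular_const)
  next
    case (Cons l w)
    then show ?case by (simp add: regular_mat_mult regL)
  qed
  define F where "F = (\<lambda>z. \<Sum>w\<in>Poly_Mapping.keys f. Poly_Mapping.lookup f w * word_prod n (L z) w $$ (a, b))"
  have "regular_at_i F"
    unfolding F_def
  proof (intro regular_sum regular_mult regular_const)
    fix w assume "w \<in> Poly_Mapping.keys f"
    then show "regular_at_i (\<lambda>z. word_prod n (L z) w $$ (a, b))"
      using regw[of w] fI ab by (simp add: regular_mat_def)
  qed
  moreover
  assume "(\<Sum>w\<in>Poly_Mapping.keys f. Poly_Mapping.lookup f w * word_prod n (pair_letter n G H) w $$ (a, b)) \<noteq> 0"
  moreover have "L \<i> l = pair_letter n G H l" if "letter_index l \<in> I" for l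
    using that mat_of PQ by (cases l) (simp_all add: L_def pair_letter_def)
  then have "word_prod n (L \<i>) w = word_prod n (pair_letter n G H) w" if "w \<in> Poly_Mapping.keys f" for w
    using that fI by (intro word_prod_cong) blast
  ultimately have "finite {t :: real. F (of_real t) = 0}"
    by (intro regular_finite_zeros) (simp_all add: F_def)
  moreover have "finite (\<Union>k\<in>K. {t :: real. \<not> (unitary_mat (s * n) (P k (of_real t)) \<and> Q k (of_real t) = mat_adjoint (P k (of_real t)))})"
    using finite_K fin by blast
  ultimately have "finite ({t :: real. F (of_real t) = 0} \<union>
      (\<Union>k\<in>K. {t :: real. \<not> (unitary_mat (s * n) (P k (of_real t)) \<and> Q k (of_real t) = mat_adjoint (P k (of_real t)))}))"
    by (rule finite_UnI)
  from ex_new_if_finite[OF infinite_UNIV_char_0 this]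
  obtain t :: real where t: "F (of_real t) \<noteq> 0"
    "\<And>k. k \<in> K \<Longrightarrow> unitary_mat (s * n) (P k (of_real t))"
    "\<And>k. k \<in> K \<Longrightarrow> Q k (of_real t) = mat_adjoint (P k (of_real t))"
    by blast
  define U where "U = (\<lambda>k. P k (of_real t))"
  have LU: "letter_eval (blocks n U) l = L (of_real t) l" if "letter_index l \<in> I" for l
  proof (cases l)
    case (Adj i)
    then have "i \<in> I" using that by simp
    then have "U (mat_of i) \<in> carrier_mat (s * n) (s * n)" using t(2) mat_of by (simp add: U_def unitary_mat_def)
    then show ?thesis
      using t(3) \<open>i \<in> I\<close> mat_of row_of col_of Adj
      by (simp add: blocks_def L_def pair_letter_def adjoint_block U_def)
  qed (simp add: blocks_def L_def pair_letter_def U_def)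
  have weq: "word_eval n (blocks n U) w = word_prod n (L (of_real t)) w" if "w \<in> Poly_Mapping.keys f" for w
    unfolding word_eval_conv_word_prod using LU fI that by (intro word_prod_cong) blast
  have wc: "word_eval n (blocks n U) w \<in> carrier_mat n n" if "w \<in> Poly_Mapping.keys f" for w
    unfolding weq[OF that] by (rule word_prod_carrier) (simp add: L_def)
  have "star_eval n (blocks n U) f $$ (a, b) = F (of_real t)"
    by (simp add: star_eval_entry[OF wc ab] F_def weq)
  moreover have "star_eval n (blocks n U) f = 0\<^sub>m n n"
    by (rule vanish) (simp add: U_def t)
  ultimately show False using t(1) ab by simp
qed

end

lemma block_action:
  assumes G: "G \<in> carrier_mat (s * n) (s * n)" and "r < s" "c < s" "a < n"
  shows "(G *\<^sub>v vec (s * n) (\<lambda>t. if t div n = c then v (t mod n) else 0)) $ (r * n + a)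
       = (block n r c G *\<^sub>v vec n v) $ a"
proof -
  have "(G *\<^sub>v vec (s * n) (\<lambda>t. if t div n = c then v (t mod n) else 0)) $ (r * n + a)
      = (\<Sum>t\<in>{..<s * n}. G $$ (r * n + a, t) * (if t div n = c then v (t mod n) else 0))"
    using G assms(2,4) by (simp add: scalar_prod_def block_index_less lessThan_atLeast0)
  also have "\<dots> = (\<Sum>t\<in>(\<lambda>b. c * n + b) ` {..<n}. G $$ (r * n + a, t) * (if t div n = c then v (t mod n) else 0))"
  proof (rule sum.mono_neutral_right)
    show "\<forall>t\<in>{..<s * n} - (\<lambda>b. c * n + b) ` {..<n}. G $$ (r * n + a, t) * (if t div n = c then v (t mod n) else 0) = 0"
    proof
      fix t assume t: "t \<in> {..<s * n} - (\<lambda>b. c * n + b) ` {..<n}"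
      have "t div n \<noteq> c"
      proof
        assume "t div n = c"
        then have "t = c * n + t mod n" by (metis div_mult_mod_eq)
        moreover have "t mod n < n" using assms(4) by simp
        ultimately show False using t by blast
      qed
      then show "G $$ (r * n + a, t) * (if t div n = c then v (t mod n) else 0) = 0" by simp
    qed
  qed (use assms(3) in \<open>auto simp: block_index_less\<close>)
  also have "\<dots> = (\<Sum>b<n. G $$ (r * n + a, c * n + b) * v b)"
    by (subst sum.reindex) (auto simp: inj_on_def intro!: sum.cong)
  also have "\<dots> = (block n r c G *\<^sub>v vec n v) $ a"
    using assms(4) by (simp add: scalar_prod_def block_def lessThan_atLeast0)
  finally show ?thesis .
qed

section \<open>Words acting on coordinates\<close>

context block_indexed_letters
begin

text \<open>
  Here \<open>\<kappa>\<close> gives coordinates of the quotient algebra, and \<open>R k\<close> is the graph of a partial linear injection between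
  \<open>s\<close>-tuples of coordinate vectors. The last two conditions on \<open>R\<close> say that this injection, and its inverse, realise left
  multiplication by the letters on words of length at most \<open>d\<close>. An invertible extension \<open>G k\<close> keeps this property,
  so the blocks of \<open>G k\<close> and of its inverse carry the coordinates of the empty word to those of any word of length
  at most \<open>Suc d\<close>. By linearity the evaluation of \<open>f\<close> carries them to the coordinates of \<open>f\<close>; but that
  evaluation is zero by continuation from unitary matrices.
\<close>

lemma coordinates_vanish:
  fixes \<kappa> :: "'i star_poly \<Rightarrow> nat \<Rightarrow> complex"
    and R :: "'k \<Rightarrow> ((nat \<Rightarrow> nat \<Rightarrow> complex) \<times> (nat \<Rightarrow> nat \<Rightarrow> complex)) set"
  assumes f: "f \<in> carrier (free_star_algebra I)" and len: "\<And>w. w \<in> Poly_Mapping.keys f \<Longrightarrow> length w \<le> Suc d"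
    and vanish: "\<And>U. n \<ge> 1 \<Longrightarrow> (\<And>k. k \<in> K \<Longrightarrow> unitary_mat (s * n) (U k)) \<Longrightarrow> star_eval n (blocks n U) f = 0\<^sub>m n n"
    and \<kappa>_add: "\<And>p q a. \<kappa> (p + q) a = \<kappa> p a + \<kappa> q a"
    and \<kappa>_scale: "\<And>c p a. \<kappa> (pm_scale c p) a = c * \<kappa> p a"
    and R_zero: "\<And>k. k \<in> K \<Longrightarrow> ((\<lambda>r a. 0), (\<lambda>r a. 0)) \<in> R k"
    and R_add: "\<And>k x y x' y'. k \<in> K \<Longrightarrow> (x, y) \<in> R k \<Longrightarrow> (x', y') \<in> R k \<Longrightarrow>
      ((\<lambda>r a. x r a + x' r a), (\<lambda>r a. y r a + y' r a)) \<in> R k"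
    and R_scale: "\<And>k e x y. k \<in> K \<Longrightarrow> (x, y) \<in> R k \<Longrightarrow> ((\<lambda>r a. e * x r a), (\<lambda>r a. e * y r a)) \<in> R k"
    and R_sv: "\<And>k x y. k \<in> K \<Longrightarrow> (x, y) \<in> R k \<Longrightarrow> (\<forall>r<s. \<forall>a<n. x r a = 0) \<Longrightarrow> (\<forall>r<s. \<forall>a<n. y r a = 0)"
    and R_inj: "\<And>k x y. k \<in> K \<Longrightarrow> (x, y) \<in> R k \<Longrightarrow> (\<forall>r<s. \<forall>a<n. y r a = 0) \<Longrightarrow> (\<forall>r<s. \<forall>a<n. x r a = 0)"
    and R_Var: "\<And>i w. i \<in> I \<Longrightarrow> letter_index ` set w \<subseteq> I \<Longrightarrow> length w \<le> d \<Longrightarrow>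
      \<exists>y. ((\<lambda>c a. if c = col_of i then \<kappa> (Poly_Mapping.single w 1) a else 0), y) \<in> R (mat_of i) \<and>
          (\<forall>a<n. y (row_of i) a = \<kappa> (Poly_Mapping.single (Var i # w) 1) a)"
    and R_Adj: "\<And>i w. i \<in> I \<Longrightarrow> letter_index ` set w \<subseteq> I \<Longrightarrow> length w \<le> d \<Longrightarrow>
      \<exists>x. (x, (\<lambda>r a. if r = row_of i then \<kappa> (Poly_Mapping.single w 1) a else 0)) \<in> R (mat_of i) \<and>
          (\<forall>a<n. x (col_of i) a = \<kappa> (Poly_Mapping.single (Adj i # w) 1) a)"
    and a: "a < n"
  shows "\<kappa> f a = 0"
proof -
  define bv where "bv = (\<lambda>x :: nat \<Rightarrow> nat \<Rightarrow> complex. vec (s * n) (\<lambda>t. x (t div n) (t mod n)))"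
  have n: "n > 0" using a by simp
  have bv_dim: "bv x \<in> carrier_vec (s * n)" for x by (simp add: bv_def)
  have bv_nth: "bv x $ (r * n + a) = x r a" if "r < s" "a < n" for x r a
    using that by (simp add: bv_def block_index_less)
  have div_mod: "t div n < s" "t mod n < n" if "t < s * n" for t
    using that n by (simp_all add: less_mult_imp_div_less)
  have bv_0: "bv x = 0\<^sub>v (s * n) \<longleftrightarrow> (\<forall>r<s. \<forall>a<n. x r a = 0)" for x
  proof
    assume "bv x = 0\<^sub>v (s * n)"
    then show "\<forall>r<s. \<forall>a<n. x r a = 0" using bv_nth[of _ _ x] by (simp add: block_index_less)
  next
    assume "\<forall>r<s. \<forall>a<n. x r a = 0"
    then show "bv x = 0\<^sub>v (s * n)" using div_mod by (intro eq_vecI) (simp_all add: bv_def)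
  qed
  have bv_add: "bv (\<lambda>r a. x r a + x' r a) = bv x + bv x'" for x x' by (intro eq_vecI) (simp_all add: bv_def)
  have bv_scale: "bv (\<lambda>r a. e * x r a) = e \<cdot>\<^sub>v bv x" for e x by (intro eq_vecI) (simp_all add: bv_def)
  define extends_R where "extends_R = (\<lambda>k G H. G \<in> carrier_mat (s * n) (s * n) \<and> H \<in> carrier_mat (s * n) (s * n) \<and>
      G * H = 1\<^sub>m (s * n) \<and> H * G = 1\<^sub>m (s * n) \<and> (\<forall>x y. (x, y) \<in> R k \<longrightarrow> G *\<^sub>v bv x = bv y))"
  have "\<exists>G H. extends_R k G H" if k: "k \<in> K" for k
  proof -
    let ?R = "{(bv x, bv y) | x y. (x, y) \<in> R k}"
    obtain G H where "G \<in> carrier_mat (s * n) (s * n)" "H \<in> carrier_mat (s * n) (s * n)" "G * H = 1\<^sub>m (s * n)"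
      "H * G = 1\<^sub>m (s * n)" and *: "\<And>x y. (x, y) \<in> ?R \<Longrightarrow> G *\<^sub>v x = y"
    proof (rule partial_injection_extends_to_invertible_matrix[of ?R "s * n"])
      have "bv (\<lambda>r a. 0) = 0\<^sub>v (s * n)" by (simp add: bv_0)
      then show "(0\<^sub>v (s * n), 0\<^sub>v (s * n)) \<in> ?R" using R_zero[OF k] by force
    next
      fix x y x' y' assume "(x, y) \<in> ?R" "(x', y') \<in> ?R"
      then obtain u v u' v' where "(u, v) \<in> R k" "(u', v') \<in> R k" and xy: "x = bv u" "y = bv v" "x' = bv u'" "y' = bv v'"
        by blast
      then have "((\<lambda>r a. u r a + u' r a), (\<lambda>r a. v r a + v' r a)) \<in> R k" by (intro R_add[OF k])
      then show "(x + x', y + y') \<in> ?R" unfolding xy bv_add[symmetric] by blast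
    next
      fix e x y assume "(x, y) \<in> ?R"
      then obtain u v where "(u, v) \<in> R k" and xy: "x = bv u" "y = bv v" by blast
      then have "((\<lambda>r a. e * u r a), (\<lambda>r a. e * v r a)) \<in> R k" by (intro R_scale[OF k])
      then show "(e \<cdot>\<^sub>v x, e \<cdot>\<^sub>v y) \<in> ?R" unfolding xy bv_scale[symmetric] by blast
    next
      fix y assume "(0\<^sub>v (s * n), y) \<in> ?R"
      then obtain x' y' where "(x', y') \<in> R k" "bv x' = 0\<^sub>v (s * n)" "y = bv y'" by auto
      then show "y = 0\<^sub>v (s * n)" using R_sv[OF k] by (simp add: bv_0)
    next
      fix x assume "(x, 0\<^sub>v (s * n)) \<in> ?R"
      then obtain x' y' where "(x', y') \<in> R k" "bv y' = 0\<^sub>v (s * n)" "x = bv x'" by force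
      then show "x = 0\<^sub>v (s * n)" using R_inj[OF k] by (simp add: bv_0)
    qed (auto simp: bv_dim)
    then show ?thesis unfolding extends_R_def by blast
  qed
  then obtain G H where extends_R: "extends_R k (G k) (H k)" if "k \<in> K" for k by metis
  then have GH: "G k \<in> carrier_mat (s * n) (s * n)" "H k \<in> carrier_mat (s * n) (s * n)" "G k * H k = 1\<^sub>m (s * n)"
    and HG: "H k * G k = 1\<^sub>m (s * n)"
    and GR: "(x, y) \<in> R k \<Longrightarrow> G k *\<^sub>v bv x = bv y" if "k \<in> K" for k x y
    using that unfolding extends_R_def by simp_all
  have HR: "H k *\<^sub>v bv y = bv x" if "k \<in> K" "(x, y) \<in> R k" for k x y
  proof -
    have "H k *\<^sub>v bv y = H k *\<^sub>v (G k *\<^sub>v bv x)" by (simp add: GR[OF that])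
    also have "\<dots> = (H k * G k) *\<^sub>v bv x" by (rule assoc_mult_mat_vec[symmetric, OF GH(2,1)[OF that(1)] bv_dim])
    finally show ?thesis using HG[OF that(1)] bv_dim by simp
  qed
  define kv where "kv = (\<lambda>w. vec n (\<kappa> (Poly_Mapping.single w 1)))"
  let ?L = "pair_letter n G H"
  have step: "?L l *\<^sub>v kv w = kv (l # w)"
    if l: "letter_index l \<in> I" and w: "letter_index ` set w \<subseteq> I" "length w \<le> d" for l w
  proof (cases l)
    case (Var i)
    then have i: "i \<in> I" using l by simp
    obtain y where y: "((\<lambda>c a. if c = col_of i then \<kappa> (Poly_Mapping.single w 1) a else 0), y) \<in> R (mat_of i)"
      "\<forall>a<n. y (row_of i) a = \<kappa> (Poly_Mapping.single (Var i # w) 1) a"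
      using R_Var[OF i w] by blast
    show ?thesis
    proof (rule eq_vecI)
      fix b assume "b < dim_vec (kv (l # w))"
      then have b: "b < n" by (simp add: kv_def)
      have "(?L l *\<^sub>v kv w) $ b = (G (mat_of i) *\<^sub>v bv (\<lambda>c a. if c = col_of i then \<kappa> (Poly_Mapping.single w 1) a else 0)) $ (row_of i * n + b)"
        using block_action[OF GH(1)[OF mat_of[OF i]] row_of[OF i] col_of[OF i] b]
        by (simp add: Var pair_letter_def kv_def bv_def)
      also have "\<dots> = kv (l # w) $ b"
        unfolding GR[OF mat_of[OF i] y(1)] using y(2) b bv_nth[OF row_of[OF i] b] by (simp add: kv_def Var)
      finally show "(?L l *\<^sub>v kv w) $ b = kv (l # w) $ b" .
    qed (simp add: Var pair_letter_def kv_def block_def)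
  next
    case (Adj i)
    then have i: "i \<in> I" using l by simp
    obtain x where x: "(x, (\<lambda>r a. if r = row_of i then \<kappa> (Poly_Mapping.single w 1) a else 0)) \<in> R (mat_of i)"
      "\<forall>a<n. x (col_of i) a = \<kappa> (Poly_Mapping.single (Adj i # w) 1) a"
      using R_Adj[OF i w] by blast
    show ?thesis
    proof (rule eq_vecI)
      fix b assume "b < dim_vec (kv (l # w))"
      then have b: "b < n" by (simp add: kv_def)
      have "(?L l *\<^sub>v kv w) $ b = (H (mat_of i) *\<^sub>v bv (\<lambda>c a. if c = row_of i then \<kappa> (Poly_Mapping.single w 1) a else 0)) $ (col_of i * n + b)"
        using block_action[OF GH(2)[OF mat_of[OF i]] col_of[OF i] row_of[OF i] b]
        by (simp add: Adj pair_letter_def kv_def bv_def)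
      also have "\<dots> = kv (l # w) $ b"
        unfolding HR[OF mat_of[OF i] x(1)] using x(2) b bv_nth[OF col_of[OF i] b] by (simp add: kv_def Adj)
      finally show "(?L l *\<^sub>v kv w) $ b = kv (l # w) $ b" .
    qed (simp add: Adj pair_letter_def kv_def block_def)
  qed
  have words: "word_prod n ?L w *\<^sub>v kv [] = kv w"
    if "letter_index ` set w \<subseteq> I" "length w \<le> Suc d" for w
    using that
  proof (induction w)
    case Nil
    then show ?case by (simp add: kv_def)
  next
    case (Cons l w)
    have "word_prod n ?L (l # w) *\<^sub>v kv [] = ?L l *\<^sub>v (word_prod n ?L w *\<^sub>v kv [])"
      unfolding word_prod_simps
      by (rule assoc_mult_mat_vec[of _ n n _ n]) (simp_all add: word_prod_carrier kv_def)
    also have "\<dots> = kv (l # w)" using Cons step by simp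
    finally show ?case .
  qed
  have \<kappa>_0: "\<kappa> 0 a = 0" using \<kappa>_scale[of 0 0 a] by simp
  have \<kappa>_sum: "\<kappa> (\<Sum>w\<in>S. pm_scale (e w) (Poly_Mapping.single w 1)) a = (\<Sum>w\<in>S. e w * \<kappa> (Poly_Mapping.single w 1) a)"
    if "finite S" for S e
    using that by (induction S) (simp_all add: \<kappa>_0 \<kappa>_add \<kappa>_scale)
  have "\<kappa> f a = (\<Sum>w\<in>Poly_Mapping.keys f. Poly_Mapping.lookup f w * \<kappa> (Poly_Mapping.single w 1) a)"
    by (subst pm_expansion[OF finite_keys subset_refl]) (rule \<kappa>_sum[OF finite_keys])
  also have "\<dots> = (\<Sum>w\<in>Poly_Mapping.keys f. Poly_Mapping.lookup f w *
      (\<Sum>b<n. word_prod n ?L w $$ (a, b) * kv [] $ b))"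
  proof (intro sum.cong refl arg_cong2[of _ _ _ _ "(*)"])
    fix w assume w: "w \<in> Poly_Mapping.keys f"
    then have wI: "letter_index ` set w \<subseteq> I" using f by (simp add: free_star_algebra_def)
    have c: "word_prod n ?L w \<in> carrier_mat n n" by (rule word_prod_carrier) simp
    have "\<kappa> (Poly_Mapping.single w 1) a = (word_prod n ?L w *\<^sub>v kv []) $ a"
      using words[OF wI len[OF w]] a by (simp add: kv_def)
    also have "\<dots> = (\<Sum>b<n. word_prod n ?L w $$ (a, b) * kv [] $ b)"
      using c a by (simp add: kv_def scalar_prod_def lessThan_atLeast0)
    finally show "\<kappa> (Poly_Mapping.single w 1) a = (\<Sum>b<n. word_prod n ?L w $$ (a, b) * kv [] $ b)" .
  qed
  also have "\<dots> = (\<Sum>b<n. (\<Sum>w\<in>Poly_Mapping.keys f. Poly_Mapping.lookup f w * word_prod n ?L w $$ (a, b)) * kv [] $ b)"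
    unfolding sum_distrib_left sum_distrib_right
    by (subst sum.swap) (simp add: mult.assoc)
  also have "\<dots> = 0"
    using vanishing_extends_to_inverse_pairs[OF f GH vanish a] n by (intro sum.neutral) simp
  finally show ?thesis .
qed

end

section \<open>Ideals of the free algebra\<close>

definition words_upto :: "'i set \<Rightarrow> nat \<Rightarrow> 'i letter list set" where
  "words_upto I d = {w. letter_index ` set w \<subseteq> I \<and> length w \<le> d}"

lemma finite_words_upto: "finite I \<Longrightarrow> finite (words_upto I d)"
proof -
  assume I: "finite I"
  have "words_upto I d \<subseteq> {w. set w \<subseteq> Var ` I \<union> Adj ` I \<and> length w \<le> d}"
  proof
    fix w assume w: "w \<in> words_upto I d"
    have "l \<in> Var ` I \<union> Adj ` I" if "l \<in> set w" for l
      using w that by (cases l) (auto simp: words_upto_def)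
    then show "w \<in> {w. set w \<subseteq> Var ` I \<union> Adj ` I \<and> length w \<le> d}" using w by (auto simp: words_upto_def)
  qed
  then show ?thesis by (rule finite_subset) (simp add: finite_lists_length_le I)
qed

lemma words_upto_mono: "d \<le> e \<Longrightarrow> words_upto I d \<subseteq> words_upto I e"
  by (auto simp: words_upto_def)

abbreviation polys_upto :: "'i set \<Rightarrow> nat \<Rightarrow> 'i star_poly set" where
  "polys_upto I d \<equiv> {p. Poly_Mapping.keys p \<subseteq> words_upto I d}"

lemma subspace_polys_upto: "pm.subspace (polys_upto I d)"
  by (rule subspace_keys_subset)

lemma polys_upto_carrier: "p \<in> polys_upto I d \<Longrightarrow> p \<in> carrier (free_star_algebra I)"
  by (auto simp: free_star_algebra_def words_upto_def)

lemma var_carrier: "i \<in> I \<Longrightarrow> var i \<in> carrier (free_star_algebra I)"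
  and avar_carrier: "i \<in> I \<Longrightarrow> avar i \<in> carrier (free_star_algebra I)"
  by (simp_all add: free_star_algebra_def var_def avar_def)

lemma var_mult_single: "var i * Poly_Mapping.single w 1 = Poly_Mapping.single (Var i # w) 1"
  and avar_mult_single: "avar i * Poly_Mapping.single w 1 = Poly_Mapping.single (Adj i # w) 1"
  by (simp_all add: var_def avar_def mult_single plus_list_def)

text \<open>
  Constants are central since the empty word commutes with every word.
\<close>

lemma pm_scale_mult_right: "p * pm_scale c q = pm_scale c (p * q)" for p q :: "'i star_poly"
proof -
  have "p * Poly_Mapping.single 0 c = Poly_Mapping.single 0 c * p"
  proof (rule poly_mapping_eqI)
    fix w
    have "p * Poly_Mapping.single 0 c = (\<Sum>v\<in>Poly_Mapping.keys p. pm_scale (Poly_Mapping.lookup p v) (Poly_Mapping.single v 1) * Poly_Mapping.single 0 c)"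
      by (subst (1) pm_expansion[OF finite_keys subset_refl]) (simp add: sum_distrib_right)
    also have "\<dots> = (\<Sum>v\<in>Poly_Mapping.keys p. Poly_Mapping.single 0 c * pm_scale (Poly_Mapping.lookup p v) (Poly_Mapping.single v 1))"
      by (intro sum.cong) (simp_all add: pm_scale_conv_mult mult_single mult.commute)
    also have "\<dots> = Poly_Mapping.single 0 c * p"
      by (subst (2) pm_expansion[OF finite_keys subset_refl]) (simp add: sum_distrib_left)
    finally show "Poly_Mapping.lookup (p * Poly_Mapping.single 0 c) w = Poly_Mapping.lookup (Poly_Mapping.single 0 c * p) w" by simp
  qed
  then show ?thesis by (simp add: pm_scale_conv_mult mult.assoc[symmetric])
qed

lemma letter_mult_polys_upto:
  assumes "i \<in> I" "p \<in> polys_upto I d"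
  shows "var i * p \<in> polys_upto I (Suc d)" "avar i * p \<in> polys_upto I (Suc d)"
proof -
  have *: "Poly_Mapping.single [l] 1 * p \<in> polys_upto I (Suc d)" if l: "letter_index l \<in> I" for l
  proof
    show "Poly_Mapping.keys (Poly_Mapping.single [l] 1 * p) \<subseteq> words_upto I (Suc d)"
    proof
      fix w assume "w \<in> Poly_Mapping.keys (Poly_Mapping.single [l] 1 * p)"
      then obtain u v where "w = u + v" "u \<in> Poly_Mapping.keys (Poly_Mapping.single [l] (1::complex))" "v \<in> Poly_Mapping.keys p"
        using keys_mult[of "Poly_Mapping.single [l] 1" p] by blast
      then show "w \<in> words_upto I (Suc d)" using assms(2) l by (auto simp: plus_list_def words_upto_def split: if_splits)
    qed
  qed
  show "var i * p \<in> polys_upto I (Suc d)" "avar i * p \<in> polys_upto I (Suc d)"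
    using *[of "Var i"] *[of "Adj i"] assms(1) by (simp_all add: var_def avar_def)
qed

lemma single_polys_upto:
  "letter_index ` set w \<subseteq> I \<Longrightarrow> length w \<le> d \<Longrightarrow> Poly_Mapping.single w 1 \<in> polys_upto I d"
  by (simp add: words_upto_def)

locale free_star_ideal = ideal J "free_star_algebra I" for I :: "'i set" and J +
  assumes finite_I: "finite I"
begin

lemma J_mult_left: "p \<in> carrier (free_star_algebra I) \<Longrightarrow> q \<in> J \<Longrightarrow> p * q \<in> J"
  using I_l_closed[of q p] by (simp add: free_star_algebra_def)

lemma J_mult_right: "p \<in> carrier (free_star_algebra I) \<Longrightarrow> q \<in> J \<Longrightarrow> q * p \<in> J"
  using I_r_closed[of q p] by (simp add: free_star_algebra_def)

lemma J_subspace: "pm.subspace J"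
proof (rule pm.subspaceI)
  show "0 \<in> J" using additive_subgroup.zero_closed[OF is_additive_subgroup] by (simp add: free_star_algebra_def)
  show "p + q \<in> J" if "p \<in> J" "q \<in> J" for p q
    using additive_subgroup.a_closed[OF is_additive_subgroup that] by (simp add: free_star_algebra_def)
  show "pm_scale c p \<in> J" if "p \<in> J" for c p
    unfolding pm_scale_conv_mult using that
    by (rule J_mult_left[rotated]) (auto simp: free_star_algebra_def zero_list_def)
qed

lemmas J_0 = pm.subspace_0[OF J_subspace]
  and J_add = pm.subspace_add[OF J_subspace]
  and J_diff = pm.subspace_diff[OF J_subspace]
  and J_scale = pm.subspace_scale[OF J_subspace]
  and J_sum = pm.subspace_sum[OF J_subspace]

lemma J_congD: "p - q \<in> J \<Longrightarrow> q \<in> J \<Longrightarrow> p \<in> J"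
  using J_add[of "p - q" q] by simp

lemma coordinates:
  obtains n and \<kappa> :: "'i star_poly \<Rightarrow> nat \<Rightarrow> complex"
  where "\<And>p q a. \<kappa> (p + q) a = \<kappa> p a + \<kappa> q a"
    and "\<And>c p a. \<kappa> (pm_scale c p) a = c * \<kappa> p a"
    and "\<And>p a. p \<in> J \<Longrightarrow> \<kappa> p a = 0"
    and "\<And>p. p \<in> polys_upto I d \<Longrightarrow> (\<forall>a<n. \<kappa> p a = 0) \<Longrightarrow> p \<in> J"
  by (rule finite_coordinates_modulo_subspace[OF J_subspace finite_words_upto[OF finite_I, of d]]) auto

end

lemma degree_bound:
  assumes "f \<in> carrier (free_star_algebra I)"
  obtains d where "f \<in> polys_upto I (Suc d)"
proof (rule that)
  let ?d = "Max (length ` Poly_Mapping.keys f)"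
  show "f \<in> polys_upto I (Suc ?d)"
    using assms by (auto simp: words_upto_def free_star_algebra_def intro!: le_SucI)
qed

section \<open>Relations of unitary block matrices\<close>

text \<open>
  The injection relates a column \<open>v\<close> of polynomials to a column \<open>u\<close> when \<open>u\<close> is congruent to the matrix of the letters
  \<open>X\<close> times \<open>v\<close>, and \<open>v\<close> to the matrix of the letters \<open>X\<^sup>\<intercal>\<close> times \<open>u\<close>. As either congruence follows from the other
  modulo the relations, the domain contains all columns of degree at most \<open>d\<close>, and so does the range. If one column has zero coordinates, it lies in
  \<open>J\<close>, and then so does the other: this is injectivity, and it is where the degree bound on both columns is used.
\<close>

lemma biunitary_membership:
  fixes letter :: "'k \<Rightarrow> nat \<Rightarrow> nat \<Rightarrow> 'i"
  assumes "free_star_ideal I J" and "block_indexed_letters I K s mat_of row_of col_of"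
    and letter: "\<And>i. i \<in> I \<Longrightarrow> letter (mat_of i) (row_of i) (col_of i) = i"
    and letter_I: "\<And>k r c. k \<in> K \<Longrightarrow> r < s \<Longrightarrow> c < s \<Longrightarrow> letter k r c \<in> I"
    and XY: "\<And>k r c. k \<in> K \<Longrightarrow> r < s \<Longrightarrow> c < s \<Longrightarrow>
      (if r = c then 1 else 0) - (\<Sum>t<s. var (letter k r t) * avar (letter k c t)) \<in> J"
    and YX: "\<And>k r c. k \<in> K \<Longrightarrow> r < s \<Longrightarrow> c < s \<Longrightarrow>
      (if r = c then 1 else 0) - (\<Sum>t<s. avar (letter k t r) * var (letter k t c)) \<in> J"
    and f: "f \<in> carrier (free_star_algebra I)"
    and vanish: "\<And>n U. n \<ge> 1 \<Longrightarrow> (\<And>k. k \<in> K \<Longrightarrow> unitary_mat (s * n) (U k)) \<Longrightarrow>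
      star_eval n (block_indexed_letters.blocks mat_of row_of col_of n U) f = 0\<^sub>m n n"
  shows "f \<in> J"
proof -
  interpret free_star_ideal I J by fact
  interpret block_indexed_letters I K s mat_of row_of col_of by fact
  obtain d where fd: "f \<in> polys_upto I (Suc d)" using degree_bound[OF f] .
  obtain n and \<kappa> :: "'i star_poly \<Rightarrow> nat \<Rightarrow> complex"
    where \<kappa>_add: "\<And>p q a. \<kappa> (p + q) a = \<kappa> p a + \<kappa> q a"
      and \<kappa>_scale: "\<And>c p a. \<kappa> (pm_scale c p) a = c * \<kappa> p a"
      and \<kappa>_J: "\<And>p a. p \<in> J \<Longrightarrow> \<kappa> p a = 0"
      and \<kappa>_D: "\<And>p. p \<in> polys_upto I (Suc d) \<Longrightarrow> (\<forall>a<n. \<kappa> p a = 0) \<Longrightarrow> p \<in> J"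
    by (rule coordinates[of "Suc d"]) (rule that; assumption)
  define Q where "Q = (\<lambda>k v u. (\<forall>r<s. v r \<in> polys_upto I (Suc d)) \<and> (\<forall>r<s. u r \<in> polys_upto I (Suc d)) \<and>
      (\<forall>r<s. u r - (\<Sum>c<s. var (letter k r c) * v c) \<in> J) \<and>
      (\<forall>c<s. v c - (\<Sum>r<s. avar (letter k r c) * u r) \<in> J))"
  have QD: "v r \<in> polys_upto I (Suc d)" "u r \<in> polys_upto I (Suc d)"
      "u r - (\<Sum>c<s. var (letter k r c) * v c) \<in> J" "v r - (\<Sum>c<s. avar (letter k c r) * u c) \<in> J"
    if "Q k v u" "r < s" for k v u r
    using that unfolding Q_def by simp_all
  define R where "R = (\<lambda>k. {(\<lambda>r. \<kappa> (v r), \<lambda>r. \<kappa> (u r)) | v u. Q k v u})"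
  have RI: "(\<lambda>r. \<kappa> (v r), \<lambda>r. \<kappa> (u r)) \<in> R k" if "Q k v u" for k v u
    using that unfolding R_def by blast
  note sub = subspace_polys_upto[of I "Suc d"]
  note P0 = pm.subspace_0[OF sub] and Padd = pm.subspace_add[OF sub] and Pscale = pm.subspace_scale[OF sub]
  have \<kappa>_0: "\<kappa> 0 = (\<lambda>a. 0)" using \<kappa>_J[OF J_0] by blast
  have "\<kappa> f a = 0" if "a < n" for a
  proof (rule coordinates_vanish[OF f, where R = R and \<kappa> = \<kappa> and d = d])
    fix k assume k: "k \<in> K"
    have "Q k (\<lambda>r. 0) (\<lambda>r. 0)" unfolding Q_def using P0 J_0 by simp
    then show "((\<lambda>r a. 0), (\<lambda>r a. 0)) \<in> R k" using RI[of k "\<lambda>r. 0" "\<lambda>r. 0"] by (simp add: \<kappa>_0)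
  next
    fix k x y x' y' assume k: "k \<in> K" and "(x, y) \<in> R k" "(x', y') \<in> R k"
    then obtain v u v' u' where Q: "Q k v u" "Q k v' u'"
      and xy: "x = (\<lambda>r. \<kappa> (v r))" "y = (\<lambda>r. \<kappa> (u r))" "x' = (\<lambda>r. \<kappa> (v' r))" "y' = (\<lambda>r. \<kappa> (u' r))"
      unfolding R_def by blast
    have "Q k (\<lambda>r. v r + v' r) (\<lambda>r. u r + u' r)"
      unfolding Q_def
    proof (intro conjI allI impI)
      fix r assume r: "r < s"
      show "v r + v' r \<in> polys_upto I (Suc d)" by (rule Padd[OF QD(1)[OF Q(1) r] QD(1)[OF Q(2) r]])
      show "u r + u' r \<in> polys_upto I (Suc d)" by (rule Padd[OF QD(2)[OF Q(1) r] QD(2)[OF Q(2) r]])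
      have "(u r - (\<Sum>c<s. var (letter k r c) * v c)) + (u' r - (\<Sum>c<s. var (letter k r c) * v' c)) \<in> J"
        by (rule J_add[OF QD(3)[OF Q(1) r] QD(3)[OF Q(2) r]])
      then show "u r + u' r - (\<Sum>c<s. var (letter k r c) * (v c + v' c)) \<in> J"
        by (simp add: distrib_left sum.distrib algebra_simps)
      have "(v r - (\<Sum>c<s. avar (letter k c r) * u c)) + (v' r - (\<Sum>c<s. avar (letter k c r) * u' c)) \<in> J"
        by (rule J_add[OF QD(4)[OF Q(1) r] QD(4)[OF Q(2) r]])
      then show "v r + v' r - (\<Sum>c<s. avar (letter k c r) * (u c + u' c)) \<in> J"
        by (simp add: distrib_left sum.distrib algebra_simps)
    qed
    then show "((\<lambda>r a. x r a + x' r a), (\<lambda>r a. y r a + y' r a)) \<in> R k"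
      unfolding xy \<kappa>_add[symmetric] by (rule RI)
  next
    fix k e x y assume k: "k \<in> K" and "(x, y) \<in> R k"
    then obtain v u where Q: "Q k v u" and xy: "x = (\<lambda>r. \<kappa> (v r))" "y = (\<lambda>r. \<kappa> (u r))"
      unfolding R_def by blast
    have "Q k (\<lambda>r. pm_scale e (v r)) (\<lambda>r. pm_scale e (u r))"
      unfolding Q_def
    proof (intro conjI allI impI)
      fix r assume r: "r < s"
      show "pm_scale e (v r) \<in> polys_upto I (Suc d)" by (rule Pscale[OF QD(1)[OF Q r]])
      show "pm_scale e (u r) \<in> polys_upto I (Suc d)" by (rule Pscale[OF QD(2)[OF Q r]])
      have "pm_scale e (u r - (\<Sum>c<s. var (letter k r c) * v c)) \<in> J"
        by (rule J_scale[OF QD(3)[OF Q r]])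
      then show "pm_scale e (u r) - (\<Sum>c<s. var (letter k r c) * pm_scale e (v c)) \<in> J"
        by (simp add: pm_scale_mult_right pm.scale_right_diff_distrib pm.scale_sum_right)
      have "pm_scale e (v r - (\<Sum>c<s. avar (letter k c r) * u c)) \<in> J"
        by (rule J_scale[OF QD(4)[OF Q r]])
      then show "pm_scale e (v r) - (\<Sum>c<s. avar (letter k c r) * pm_scale e (u c)) \<in> J"
        by (simp add: pm_scale_mult_right pm.scale_right_diff_distrib pm.scale_sum_right)
    qed
    then show "((\<lambda>r a. e * x r a), (\<lambda>r a. e * y r a)) \<in> R k"
      unfolding xy \<kappa>_scale[symmetric] by (rule RI)
  next
    fix k x y assume k: "k \<in> K" and "(x, y) \<in> R k" and 0: "\<forall>r<s. \<forall>a<n. x r a = 0"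
    then obtain v u where Q: "Q k v u" and xy: "x = (\<lambda>r. \<kappa> (v r))" "y = (\<lambda>r. \<kappa> (u r))"
      unfolding R_def by blast
    have v: "v c \<in> J" if "c < s" for c using \<kappa>_D[OF QD(1)[OF Q that]] 0 that unfolding xy by blast
    have "u r \<in> J" if r: "r < s" for r
    proof (rule J_congD)
      show "u r - (\<Sum>c<s. var (letter k r c) * v c) \<in> J" by (rule QD(3)[OF Q r])
      show "(\<Sum>c<s. var (letter k r c) * v c) \<in> J"
        using v letter_I[OF k r] by (intro J_sum J_mult_left var_carrier) auto
    qed
    then show "\<forall>r<s. \<forall>a<n. y r a = 0" unfolding xy using \<kappa>_J by blast
  next
    fix k x y assume k: "k \<in> K" and "(x, y) \<in> R k" and 0: "\<forall>r<s. \<forall>a<n. y r a = 0"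
    then obtain v u where Q: "Q k v u" and xy: "x = (\<lambda>r. \<kappa> (v r))" "y = (\<lambda>r. \<kappa> (u r))"
      unfolding R_def by blast
    have u: "u c \<in> J" if "c < s" for c using \<kappa>_D[OF QD(2)[OF Q that]] 0 that unfolding xy by blast
    have "v c \<in> J" if c: "c < s" for c
    proof (rule J_congD)
      show "v c - (\<Sum>r<s. avar (letter k r c) * u r) \<in> J" by (rule QD(4)[OF Q c])
      show "(\<Sum>r<s. avar (letter k r c) * u r) \<in> J"
        using u letter_I[OF k _ c] by (intro J_sum J_mult_left avar_carrier) auto
    qed
    then show "\<forall>r<s. \<forall>a<n. x r a = 0" unfolding xy using \<kappa>_J by blast
  next
    fix i w assume i: "i \<in> I" and w: "letter_index ` set w \<subseteq> I" "length w \<le> d"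
    let ?k = "mat_of i" and ?w = "Poly_Mapping.single w (1::complex)"
    \<comment> \<open>A word placed in one component is a column of the domain, with image the column of \<open>X\<close> times it.\<close>
    define v where "v = (\<lambda>c. if c = col_of i then ?w else 0)"
    define u where "u = (\<lambda>r. var (letter ?k r (col_of i)) * ?w)"
    have wJ: "?w \<in> polys_upto I d" by (rule single_polys_upto[OF w])
    then have wJ': "?w \<in> polys_upto I (Suc d)" using words_upto_mono[of d "Suc d" I] by auto
    have "Q ?k v u"
      unfolding Q_def
    proof (intro conjI allI impI)
      fix r assume r: "r < s"
      show "v r \<in> polys_upto I (Suc d)" using wJ' P0 by (simp add: v_def)
      show "u r \<in> polys_upto I (Suc d)"
        unfolding u_def by (intro letter_mult_polys_upto letter_I mat_of col_of i r wJ)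
      have "(\<Sum>c<s. var (letter ?k r c) * v c) = (\<Sum>c<s. if c = col_of i then var (letter ?k r c) * ?w else 0)"
        by (intro sum.cong) (auto simp: v_def)
      also have "\<dots> = u r" using col_of[OF i] by (simp add: u_def)
      finally show "u r - (\<Sum>c<s. var (letter ?k r c) * v c) \<in> J" by (simp add: J_0)
      have "((if r = col_of i then 1 else 0) - (\<Sum>t<s. avar (letter ?k t r) * var (letter ?k t (col_of i)))) * ?w \<in> J"
        by (intro J_mult_right polys_upto_carrier[OF wJ] YX mat_of col_of i r)
      then show "v r - (\<Sum>t<s. avar (letter ?k t r) * u t) \<in> J"
        by (simp add: u_def v_def left_diff_distrib sum_distrib_right mult.assoc if_distrib[of "\<lambda>x. x * _"] cong: if_cong)
    qed
    moreover have "(\<lambda>c a. if c = col_of i then \<kappa> ?w a else 0) = (\<lambda>c. \<kappa> (v c))"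
      by (auto simp: v_def \<kappa>_0)
    moreover have "u (row_of i) = Poly_Mapping.single (Var i # w) 1"
      by (simp add: u_def letter[OF i] var_mult_single)
    ultimately show "\<exists>y. ((\<lambda>c a. if c = col_of i then \<kappa> ?w a else 0), y) \<in> R ?k \<and>
        (\<forall>a<n. y (row_of i) a = \<kappa> (Poly_Mapping.single (Var i # w) 1) a)"
      using RI by (intro exI[of _ "\<lambda>r. \<kappa> (u r)"]) auto
  next
    fix i w assume i: "i \<in> I" and w: "letter_index ` set w \<subseteq> I" "length w \<le> d"
    let ?k = "mat_of i" and ?w = "Poly_Mapping.single w (1::complex)"
    \<comment> \<open>It is likewise a column of the range, with preimage the column of \<open>X\<^sup>\<intercal>\<close> times it.\<close>
    define u where "u = (\<lambda>r. if r = row_of i then ?w else 0)"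
    define v where "v = (\<lambda>c. avar (letter ?k (row_of i) c) * ?w)"
    have wJ: "?w \<in> polys_upto I d" by (rule single_polys_upto[OF w])
    then have wJ': "?w \<in> polys_upto I (Suc d)" using words_upto_mono[of d "Suc d" I] by auto
    have "Q ?k v u"
      unfolding Q_def
    proof (intro conjI allI impI)
      fix r assume r: "r < s"
      show "u r \<in> polys_upto I (Suc d)" using wJ' P0 by (simp add: u_def)
      show "v r \<in> polys_upto I (Suc d)"
        unfolding v_def by (intro letter_mult_polys_upto letter_I mat_of row_of i r wJ)
      have "(\<Sum>c<s. avar (letter ?k c r) * u c) = (\<Sum>c<s. if c = row_of i then avar (letter ?k c r) * ?w else 0)"
        by (intro sum.cong) (auto simp: u_def)
      also have "\<dots> = v r" using row_of[OF i] by (simp add: v_def)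
      finally show "v r - (\<Sum>c<s. avar (letter ?k c r) * u c) \<in> J" by (simp add: J_0)
      have "((if r = row_of i then 1 else 0) - (\<Sum>t<s. var (letter ?k r t) * avar (letter ?k (row_of i) t))) * ?w \<in> J"
        by (intro J_mult_right polys_upto_carrier[OF wJ] XY mat_of row_of i r)
      then show "u r - (\<Sum>t<s. var (letter ?k r t) * v t) \<in> J"
        by (simp add: u_def v_def left_diff_distrib sum_distrib_right mult.assoc if_distrib[of "\<lambda>x. x * _"] cong: if_cong)
    qed
    moreover have "(\<lambda>r a. if r = row_of i then \<kappa> ?w a else 0) = (\<lambda>r. \<kappa> (u r))"
      by (auto simp: u_def \<kappa>_0)
    moreover have "v (col_of i) = Poly_Mapping.single (Adj i # w) 1"
      by (simp add: v_def letter[OF i] avar_mult_single)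
    ultimately show "\<exists>x. (x, (\<lambda>r a. if r = row_of i then \<kappa> ?w a else 0)) \<in> R ?k \<and>
        (\<forall>a<n. x (col_of i) a = \<kappa> (Poly_Mapping.single (Adj i # w) 1) a)"
      using RI by (intro exI[of _ "\<lambda>c. \<kappa> (v c)"]) auto
  qed (use fd vanish \<kappa>_add \<kappa>_scale that in \<open>auto simp: words_upto_def\<close>)
  then show ?thesis using \<kappa>_D[OF fd] by blast
qed

section \<open>The relation of a row coisometry\<close>

text \<open>
  A column \<open>v\<close> is sent to \<open>(u, v - Y u, 0, \<dots>, 0)\<close>, where \<open>u\<close> is the row of the letters \<open>X\<close> times \<open>v\<close> and \<open>Y\<close> is the
  column of the letters \<open>X\<^sup>\<intercal>\<close>. The defect \<open>v - Y u\<close> makes the map injective, and it vanishes on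
  \<open>v = Y w\<close>, which is sent to \<open>(w, 0, \<dots>, 0)\<close>; so the first block column of the inverse is \<open>Y\<close>. The defect is itself a column with \<open>s\<close>
  entries but has to fit into a single block. The block size is therefore chosen \<open>s\<close> times as large as the number
  of coordinates, and everything left over is padded by zeros.
\<close>

lemma coisometry_membership:
  fixes letter :: "nat \<Rightarrow> 'i"
  assumes "free_star_ideal I J" and "block_indexed_letters I (UNIV :: unit set) s (\<lambda>_. ()) (\<lambda>_. 0) col_of"
    and s: "s \<ge> 2"
    and letter: "\<And>i. i \<in> I \<Longrightarrow> letter (col_of i) = i"
    and letter_I: "\<And>c. c < s \<Longrightarrow> letter c \<in> I"
    and XY: "1 - (\<Sum>t<s. var (letter t) * avar (letter t)) \<in> J"
    and f: "f \<in> carrier (free_star_algebra I)"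
    and vanish: "\<And>n U. n \<ge> 1 \<Longrightarrow> unitary_mat (s * n) (U ()) \<Longrightarrow>
      star_eval n (block_indexed_letters.blocks (\<lambda>_. ()) (\<lambda>_. 0) col_of n U) f = 0\<^sub>m n n"
  shows "f \<in> J"
proof -
  interpret free_star_ideal I J by fact
  interpret block_indexed_letters I "UNIV :: unit set" s "\<lambda>_. ()" "\<lambda>_. 0" col_of by fact
  obtain d where fd: "f \<in> polys_upto I (Suc d)" using degree_bound[OF f] .
  obtain n' and \<kappa> :: "'i star_poly \<Rightarrow> nat \<Rightarrow> complex"
    where \<kappa>_add: "\<And>p q a. \<kappa> (p + q) a = \<kappa> p a + \<kappa> q a"
      and \<kappa>_scale: "\<And>c p a. \<kappa> (pm_scale c p) a = c * \<kappa> p a"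
      and \<kappa>_J: "\<And>p a. p \<in> J \<Longrightarrow> \<kappa> p a = 0"
      and \<kappa>_D: "\<And>p. p \<in> polys_upto I (Suc (Suc d)) \<Longrightarrow> (\<forall>a<n'. \<kappa> p a = 0) \<Longrightarrow> p \<in> J"
    by (rule coordinates[of "Suc (Suc d)"]) (rule that; assumption)
  define n where "n = s * n'"
  have n'_n: "a < n" if "a < n'" for a
    using block_index_less[of 0 s a n'] that s by (simp add: n_def)
  have up: "p \<in> polys_upto I (Suc (Suc d))" if "p \<in> polys_upto I (Suc d)" for p
    using that words_upto_mono[of "Suc d" "Suc (Suc d)" I] by auto
  define \<kappa>' where "\<kappa>' = (\<lambda>p a. if a < n' then \<kappa> p a else 0)"
  \<comment> \<open>The column \<open>v - Y u\<close> of length \<open>s\<close>, with its coordinates written one after another.\<close>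
  define defect where "defect = (\<lambda>v (u :: 'i star_poly) a. \<kappa> (v (a div n') - avar (letter (a div n')) * u) (a mod n'))"
  define Y where "Y = (\<lambda>v u (r::nat) a. if r = 0 then \<kappa>' u a else if r = 1 then defect v u a else 0)"
  define Q where "Q = (\<lambda>v u. (\<forall>c<s. v c \<in> polys_upto I (Suc d)) \<and> u \<in> polys_upto I (Suc d) \<and>
      u - (\<Sum>c<s. var (letter c) * v c) \<in> J)"
  have QD: "c < s \<Longrightarrow> v c \<in> polys_upto I (Suc d)" "u \<in> polys_upto I (Suc d)"
      "u - (\<Sum>c<s. var (letter c) * v c) \<in> J"
    if "Q v u" for v u c
    using that unfolding Q_def by simp_all
  define R where "R = (\<lambda>_ :: unit. {(\<lambda>c. \<kappa>' (v c), Y v u) | v u. Q v u})"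
  have RI: "(\<lambda>c. \<kappa>' (v c), Y v u) \<in> R k" if "Q v u" for k v u
    using that unfolding R_def by blast
  note sub = subspace_polys_upto[of I "Suc d"]
  note P0 = pm.subspace_0[OF sub] and Padd = pm.subspace_add[OF sub] and Pscale = pm.subspace_scale[OF sub]
  have \<kappa>_0: "\<kappa> 0 = (\<lambda>a. 0)" using \<kappa>_J[OF J_0] by blast
  have \<kappa>'_0: "\<kappa>' 0 = (\<lambda>a. 0)" by (auto simp: \<kappa>'_def \<kappa>_0)
  have \<kappa>'_add: "\<kappa>' (p + q) a = \<kappa>' p a + \<kappa>' q a" for p q a by (simp add: \<kappa>'_def \<kappa>_add)
  have \<kappa>'_scale: "\<kappa>' (pm_scale c p) a = c * \<kappa>' p a" for c p a by (simp add: \<kappa>'_def \<kappa>_scale)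
  have Y_add: "Y (\<lambda>c. v c + v' c) (u + u') r a = Y v u r a + Y v' u' r a" for v v' u u' r a
  proof -
    have eq: "v c + v' c - avar (letter c) * (u + u') = (v c - avar (letter c) * u) + (v' c - avar (letter c) * u')" for c
      by (simp add: distrib_left)
    have "defect (\<lambda>c. v c + v' c) (u + u') a = defect v u a + defect v' u' a"
      unfolding defect_def eq by (rule \<kappa>_add)
    then show ?thesis by (simp add: Y_def \<kappa>'_add)
  qed
  have Y_scale: "Y (\<lambda>c. pm_scale e (v c)) (pm_scale e u) r a = e * Y v u r a" for e v u r a
  proof -
    have eq: "pm_scale e (v c) - avar (letter c) * pm_scale e u = pm_scale e (v c - avar (letter c) * u)" for c
      by (simp add: pm_scale_mult_right pm.scale_right_diff_distrib)
    have "defect (\<lambda>c. pm_scale e (v c)) (pm_scale e u) a = e * defect v u a"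
      unfolding defect_def eq by (rule \<kappa>_scale)
    then show ?thesis by (simp add: Y_def \<kappa>'_scale)
  qed
  have "\<kappa>' f a = 0" if "a < n" for a
  proof (rule coordinates_vanish[OF f, where R = R and \<kappa> = \<kappa>' and d = d])
    have "Q (\<lambda>c. 0) 0" unfolding Q_def using P0 J_0 by simp
    moreover have "Y (\<lambda>c. 0) 0 = (\<lambda>r a. 0)" by (intro ext) (simp add: Y_def defect_def \<kappa>'_0 \<kappa>_0)
    ultimately show "((\<lambda>r a. 0), (\<lambda>r a. 0)) \<in> R k" for k using RI[of "\<lambda>c. 0" 0 k] by (simp add: \<kappa>'_0)
  next
    fix k x y x' y' assume "(x, y) \<in> R k" "(x', y') \<in> R k"
    then obtain v u v' u' where Q: "Q v u" "Q v' u'"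
      and xy: "x = (\<lambda>c. \<kappa>' (v c))" "y = Y v u" "x' = (\<lambda>c. \<kappa>' (v' c))" "y' = Y v' u'"
      unfolding R_def by blast
    have "Q (\<lambda>c. v c + v' c) (u + u')"
      unfolding Q_def
    proof (intro conjI allI impI)
      show "v c + v' c \<in> polys_upto I (Suc d)" if "c < s" for c by (rule Padd[OF QD(1)[OF Q(1) that] QD(1)[OF Q(2) that]])
      show "u + u' \<in> polys_upto I (Suc d)" by (rule Padd[OF QD(2)[OF Q(1)] QD(2)[OF Q(2)]])
      have "(u - (\<Sum>c<s. var (letter c) * v c)) + (u' - (\<Sum>c<s. var (letter c) * v' c)) \<in> J"
        by (rule J_add[OF QD(3)[OF Q(1)] QD(3)[OF Q(2)]])
      then show "u + u' - (\<Sum>c<s. var (letter c) * (v c + v' c)) \<in> J"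
        by (simp add: distrib_left sum.distrib algebra_simps)
    qed
    then show "((\<lambda>r a. x r a + x' r a), (\<lambda>r a. y r a + y' r a)) \<in> R k"
      unfolding xy \<kappa>'_add[symmetric] Y_add[symmetric] by (rule RI)
  next
    fix k e x y assume "(x, y) \<in> R k"
    then obtain v u where Q: "Q v u" and xy: "x = (\<lambda>c. \<kappa>' (v c))" "y = Y v u"
      unfolding R_def by blast
    have "Q (\<lambda>c. pm_scale e (v c)) (pm_scale e u)"
      unfolding Q_def
    proof (intro conjI allI impI)
      show "pm_scale e (v c) \<in> polys_upto I (Suc d)" if "c < s" for c by (rule Pscale[OF QD(1)[OF Q that]])
      show "pm_scale e u \<in> polys_upto I (Suc d)" by (rule Pscale[OF QD(2)[OF Q]])
      have "pm_scale e (u - (\<Sum>c<s. var (letter c) * v c)) \<in> J" by (rule J_scale[OF QD(3)[OF Q]])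
      then show "pm_scale e u - (\<Sum>c<s. var (letter c) * pm_scale e (v c)) \<in> J"
        by (simp add: pm_scale_mult_right pm.scale_right_diff_distrib pm.scale_sum_right)
    qed
    then show "((\<lambda>r a. e * x r a), (\<lambda>r a. e * y r a)) \<in> R k"
      unfolding xy \<kappa>'_scale[symmetric] Y_scale[symmetric] by (rule RI)
  next
    fix k x y assume "(x, y) \<in> R k" and 0: "\<forall>r<s. \<forall>a<n. x r a = 0"
    then obtain v u where Q: "Q v u" and xy: "x = (\<lambda>c. \<kappa>' (v c))" "y = Y v u"
      unfolding R_def by blast
    have v: "v c \<in> J" if "c < s" for c
    proof (rule \<kappa>_D[OF up[OF QD(1)[OF Q that]]], intro allI impI)
      fix a assume a: "a < n'"
      then have "x c a = 0" using 0 that n'_n by blast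
      then show "\<kappa> (v c) a = 0" using a by (simp add: xy \<kappa>'_def)
    qed
    have u: "u \<in> J"
    proof (rule J_congD[OF QD(3)[OF Q]])
      show "(\<Sum>c<s. var (letter c) * v c) \<in> J"
        using v letter_I by (intro J_sum J_mult_left var_carrier) auto
    qed
    have "defect v u a = 0" if "a < n" for a
    proof -
      have c: "a div n' < s" using that by (simp add: n_def less_mult_imp_div_less)
      show ?thesis unfolding defect_def
        by (intro \<kappa>_J J_diff v J_mult_left avar_carrier letter_I u c)
    qed
    then show "\<forall>r<s. \<forall>a<n. y r a = 0" unfolding xy Y_def \<kappa>'_def using \<kappa>_J[OF u] by simp
  next
    fix k x y assume "(x, y) \<in> R k" and 0: "\<forall>r<s. \<forall>a<n. y r a = 0"
    then obtain v u where Q: "Q v u" and xy: "x = (\<lambda>c. \<kappa>' (v c))" "y = Y v u"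
      unfolding R_def by blast
    have u: "u \<in> J"
    proof (rule \<kappa>_D[OF up[OF QD(2)[OF Q]]], intro allI impI)
      fix a assume a: "a < n'"
      then have "y 0 a = 0" using 0 s n'_n by simp
      then show "\<kappa> u a = 0" using a by (simp add: xy Y_def \<kappa>'_def)
    qed
    have v: "v c \<in> J" if c: "c < s" for c
    proof (rule J_congD[of _ "avar (letter c) * u"])
      show "avar (letter c) * u \<in> J" by (intro J_mult_left avar_carrier letter_I c u)
      show "v c - avar (letter c) * u \<in> J"
      proof (rule \<kappa>_D, rule pm.subspace_diff[OF subspace_polys_upto])
        show "v c \<in> polys_upto I (Suc (Suc d))" by (rule up[OF QD(1)[OF Q c]])
        show "avar (letter c) * u \<in> polys_upto I (Suc (Suc d))"
          by (rule letter_mult_polys_upto(2)[OF letter_I[OF c] QD(2)[OF Q]])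
        show "\<forall>a<n'. \<kappa> (v c - avar (letter c) * u) a = 0"
        proof (intro allI impI)
          fix a assume a: "a < n'"
          have "c * n' + a < n" unfolding n_def by (rule block_index_less[OF c a])
          then have "y 1 (c * n' + a) = 0" using 0 s by simp
          then show "\<kappa> (v c - avar (letter c) * u) a = 0" using a by (simp add: xy Y_def defect_def)
        qed
      qed
    qed
    then show "\<forall>r<s. \<forall>a<n. x r a = 0" unfolding xy \<kappa>'_def using \<kappa>_J by simp
  next
    fix i w assume i: "i \<in> I" and w: "letter_index ` set w \<subseteq> I" "length w \<le> d"
    let ?w = "Poly_Mapping.single w (1::complex)"
    define v where "v = (\<lambda>c. if c = col_of i then ?w else 0)"
    define u where "u = var i * ?w"
    have wJ: "?w \<in> polys_upto I d" by (rule single_polys_upto[OF w])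
    have wJ': "?w \<in> polys_upto I (Suc d)" by (rule single_polys_upto) (use w in simp_all)
    have "Q v u"
      unfolding Q_def
    proof (intro conjI allI impI)
      show "v c \<in> polys_upto I (Suc d)" for c using wJ' P0 by (simp add: v_def)
      show "u \<in> polys_upto I (Suc d)" unfolding u_def by (rule letter_mult_polys_upto(1)[OF i wJ])
      have "(\<Sum>c<s. var (letter c) * v c) = (\<Sum>c<s. if c = col_of i then var (letter c) * ?w else 0)"
        by (intro sum.cong) (auto simp: v_def)
      also have "\<dots> = u" using col_of[OF i] letter[OF i] by (simp add: u_def)
      finally show "u - (\<Sum>c<s. var (letter c) * v c) \<in> J" by (simp add: J_0)
    qed
    moreover have "(\<lambda>c a. if c = col_of i then \<kappa>' ?w a else 0) = (\<lambda>c. \<kappa>' (v c))"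
      by (auto simp: v_def \<kappa>'_0)
    ultimately show "\<exists>y. ((\<lambda>c a. if c = col_of i then \<kappa>' ?w a else 0), y) \<in> R () \<and>
        (\<forall>a<n. y 0 a = \<kappa>' (Poly_Mapping.single (Var i # w) 1) a)"
      using RI by (intro exI[of _ "Y v u"]) (auto simp: Y_def u_def var_mult_single)
  next
    fix i w assume i: "i \<in> I" and w: "letter_index ` set w \<subseteq> I" "length w \<le> d"
    let ?w = "Poly_Mapping.single w (1::complex)"
    define v where "v = (\<lambda>c. avar (letter c) * ?w)"
    have wJ: "?w \<in> polys_upto I d" by (rule single_polys_upto[OF w])
    have wJ': "?w \<in> polys_upto I (Suc d)" by (rule single_polys_upto) (use w in simp_all)
    have "Q v ?w"
      unfolding Q_def
    proof (intro conjI allI impI)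
      show "v c \<in> polys_upto I (Suc d)" if "c < s" for c
        unfolding v_def by (rule letter_mult_polys_upto(2)[OF letter_I[OF that] wJ])
      show "?w \<in> polys_upto I (Suc d)" by (rule wJ')
      have "(1 - (\<Sum>t<s. var (letter t) * avar (letter t))) * ?w \<in> J"
        by (intro J_mult_right polys_upto_carrier[OF wJ] XY)
      then show "?w - (\<Sum>t<s. var (letter t) * v t) \<in> J"
        by (simp add: v_def left_diff_distrib sum_distrib_right mult.assoc)
    qed
    moreover have "(\<lambda>r a. if r = 0 then \<kappa>' ?w a else 0) = Y v ?w"
      by (intro ext) (simp add: Y_def defect_def v_def \<kappa>_0)
    moreover have "v (col_of i) = Poly_Mapping.single (Adj i # w) 1"
      by (simp add: v_def letter[OF i] avar_mult_single)
    ultimately show "\<exists>x. (x, (\<lambda>r a. if r = 0 then \<kappa>' ?w a else 0)) \<in> R () \<and>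
        (\<forall>a<n. x (col_of i) a = \<kappa>' (Poly_Mapping.single (Adj i # w) 1) a)"
      using RI by (intro exI[of _ "\<lambda>c. \<kappa>' (v c)"]) auto
  qed (use fd vanish \<kappa>'_add \<kappa>'_scale that in \<open>auto simp: words_upto_def\<close>)
  then have "\<kappa> f a = 0" if "a < n'" for a using that n'_n[OF that] by (simp add: \<kappa>'_def) metis
  then show ?thesis using \<kappa>_D[OF up[OF fd]] by blast
qed

section \<open>The three vanishing theorems\<close>

lemma block_mult:
  assumes A: "A \<in> carrier_mat (s * n) (s * n)" and B: "B \<in> carrier_mat (s * n) (s * n)"
    and "r < s" "c < s" "a < n" "b < n"
  shows "block n r c (A * B) $$ (a, b) = (\<Sum>t<s. (block n r t A * block n t c B) $$ (a, b))"
proof -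
  have "block n r c (A * B) $$ (a, b) = (\<Sum>u<s * n. A $$ (r * n + a, u) * B $$ (u, c * n + b))"
    using assms by (simp add: block_def block_index_less scalar_prod_def lessThan_atLeast0)
  also have "\<dots> = (\<Sum>t<s. \<Sum>u = t * n..<t * n + n. A $$ (r * n + a, u) * B $$ (u, c * n + b))"
    by (rule sum.nat_group[symmetric])
  also have "\<dots> = (\<Sum>t<s. (block n r t A * block n t c B) $$ (a, b))"
  proof (intro sum.cong refl)
    fix t assume "t \<in> {..<s}"
    have "(\<Sum>u = t * n..<t * n + n. A $$ (r * n + a, u) * B $$ (u, c * n + b))
        = (\<Sum>u = 0..<n. A $$ (r * n + a, t * n + u) * B $$ (t * n + u, c * n + b))"
      using sum.shift_bounds_nat_ivl[of "\<lambda>u. A $$ (r * n + a, u) * B $$ (u, c * n + b)" 0 "t * n" n]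
      by (simp add: add.commute)
    then show "(\<Sum>u = t * n..<t * n + n. A $$ (r * n + a, u) * B $$ (u, c * n + b))
        = (block n r t A * block n t c B) $$ (a, b)"
      using assms(5,6) by (simp add: block_def scalar_prod_def)
  qed
  finally show ?thesis .
qed

lemma free_star_carrier_mult:
  "p \<in> carrier (free_star_algebra I) \<Longrightarrow> q \<in> carrier (free_star_algebra I) \<Longrightarrow> p * q \<in> carrier (free_star_algebra I)"
  using monoid.m_closed[OF ring.is_monoid[OF ring_free_star_algebra[of I]], of p q]
  by (simp add: free_star_algebra_def)

lemma free_star_carrier_subspace: "pm.subspace (carrier (free_star_algebra I))"
proof -
  have "carrier (free_star_algebra I) = {p. Poly_Mapping.keys p \<subseteq> {w. letter_index ` set w \<subseteq> I}}"
    by (auto simp: free_star_algebra_def)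
  then show ?thesis by (simp only: subspace_keys_subset)
qed

lemma free_star_carrier_delta_diff:
  assumes "\<And>x. x \<in> S \<Longrightarrow> F x \<in> carrier (free_star_algebra I)"
  shows "(if b then 1 else 0) - (\<Sum>x\<in>S. F x) \<in> carrier (free_star_algebra I)"
proof -
  have "1 \<in> carrier (free_star_algebra I)" by (simp add: free_star_algebra_def zero_list_def)
  then show ?thesis
    using pm.subspace_0[OF free_star_carrier_subspace]
    by (intro pm.subspace_diff[OF free_star_carrier_subspace] pm.subspace_sum[OF free_star_carrier_subspace] assms) auto
qed

lemma free_star_ideal_Idl:
  assumes "finite I" "S \<subseteq> carrier (free_star_algebra I)"
  shows "free_star_ideal I (Idl\<^bsub>free_star_algebra I\<^esub> S)"
  by (intro free_star_ideal.intro free_star_ideal_axioms.intro ring.genideal_ideal[OF ring_free_star_algebra] assms)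

lemma Idl_generator:
  "S \<subseteq> carrier (free_star_algebra I) \<Longrightarrow> p \<in> S \<Longrightarrow> p \<in> Idl\<^bsub>free_star_algebra I\<^esub> S"
  using ring.genideal_self[OF ring_free_star_algebra] by blast

lemma sum_1_atMost_conv: "(\<Sum>k\<in>{1..g}. F k) = (\<Sum>t<g. F (Suc t))" for g :: nat
  by (simp add: sum.atLeast1_atMost_eq)

lemma unitary_relations_membership:
  fixes g :: nat
  assumes f: "f \<in> carrier (free_star_algebra {1..g})"
    and vanish: "\<And>n A. n \<ge> 1 \<Longrightarrow> \<forall>j\<in>{1..g}. unitary_mat n (A j) \<Longrightarrow> star_eval n A f = 0\<^sub>m n n"
  shows "f \<in> Idl\<^bsub>free_star_algebra {1..g}\<^esub>
    ((\<lambda>j. 1 - var j * avar j) ` {1..g} \<union> (\<lambda>j. 1 - avar j * var j) ` {1..g})"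
    (is "_ \<in> Idl\<^bsub>_\<^esub> ?S")
proof -
  have "1 - p \<in> carrier (free_star_algebra {1..g})" if "p \<in> carrier (free_star_algebra {1..g})" for p
    using free_star_carrier_delta_diff[of "{()}" "\<lambda>_. p" "{1..g}" True] that by simp
  then have S: "?S \<subseteq> carrier (free_star_algebra {1..g})"
    by (auto intro!: free_star_carrier_mult var_carrier avar_carrier)
  interpret block_indexed_letters "{1..g}" "{1..g}" 1 "\<lambda>j. j" "\<lambda>_. 0" "\<lambda>_. 0"
    by unfold_locales auto
  show ?thesis
  proof (rule biunitary_membership[OF free_star_ideal_Idl[OF _ S] block_indexed_letters_axioms,
        where letter = "\<lambda>k _ _. k", OF _ _ _ _ _ f])
    fix k r c :: nat assume "k \<in> {1..g}" "r < 1" "c < 1"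
    then show "(if r = c then 1 else 0) - (\<Sum>t<1::nat. var k * avar k) \<in> Idl\<^bsub>free_star_algebra {1..g}\<^esub> ?S"
      "(if r = c then 1 else 0) - (\<Sum>t<1::nat. avar k * var k) \<in> Idl\<^bsub>free_star_algebra {1..g}\<^esub> ?S"
      using Idl_generator[OF S] by auto
  next
    fix n :: nat and U :: "nat \<Rightarrow> complex mat"
    assume n: "n \<ge> 1" and U: "\<And>k. k \<in> {1..g} \<Longrightarrow> unitary_mat (1 * n) (U k)"
    have "blocks n U j = U j" if "j \<in> {1..g}" for j
      using U[OF that] by (auto simp: blocks_def block_def unitary_mat_def intro!: eq_matI)
    then show "star_eval n (blocks n U) f = 0\<^sub>m n n"
      using U n by (intro vanish) auto
  qed auto
qed

text \<open>
  The first block row of a unitary matrix is a coisometry, so that the hypothesis on \<open>f\<close> applies to its blocks.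
\<close>

lemma coisometry_relation_membership:
  fixes g :: nat
  assumes g: "g \<ge> 2" and f: "f \<in> carrier (free_star_algebra {1..g})"
    and vanish: "\<And>n A. n \<ge> 1 \<Longrightarrow> \<forall>j\<in>{1..g}. A j \<in> carrier_mat n n \<Longrightarrow>
      (\<Oplus>\<^bsub>ring_mat TYPE(complex) n ()\<^esub>j\<in>{1..g}. A j * mat_adjoint (A j)) = 1\<^sub>m n \<Longrightarrow>
      star_eval n A f = 0\<^sub>m n n"
  shows "f \<in> Idl\<^bsub>free_star_algebra {1..g}\<^esub> {1 - (\<Sum>j\<in>{1..g}. var j * avar j)}"
    (is "_ \<in> Idl\<^bsub>_\<^esub> ?S")
proof -
  have "(\<Sum>j\<in>{1..g}. var j * avar j) \<in> carrier (free_star_algebra {1..g})"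
    by (intro pm.subspace_sum[OF free_star_carrier_subspace] free_star_carrier_mult var_carrier avar_carrier)
  then have S: "?S \<subseteq> carrier (free_star_algebra {1..g})"
    using free_star_carrier_delta_diff[of "{()}" "\<lambda>_. \<Sum>j\<in>{1..g}. var j * avar j" "{1..g}" True] by simp
  interpret block_indexed_letters "{1..g}" "UNIV :: unit set" g "\<lambda>_. ()" "\<lambda>_. 0" "\<lambda>j. j - Suc 0"
    using g by unfold_locales auto
  show ?thesis
  proof (rule coisometry_membership[OF free_star_ideal_Idl[OF _ S] block_indexed_letters_axioms g,
        where letter = Suc, OF _ _ _ _ f])
    show "1 - (\<Sum>t<g. var (Suc t) * avar (Suc t)) \<in> Idl\<^bsub>free_star_algebra {1..g}\<^esub> ?S"
      unfolding sum_1_atMost_conv[symmetric, of "\<lambda>j. var j * avar j"] by (rule Idl_generator[OF S]) simp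
  next
    fix n :: nat and U :: "unit \<Rightarrow> complex mat"
    assume n: "n \<ge> 1" and "unitary_mat (g * n) (U ())"
    then have U: "U () \<in> carrier_mat (g * n) (g * n)" "U () * mat_adjoint (U ()) = 1\<^sub>m (g * n)"
      by (auto simp: unitary_mat_def)
    note U' = adjoint_carrier[OF U(1)]
    have adj: "mat_adjoint (blocks n U (Suc c)) = block n c 0 (mat_adjoint (U ()))" if "c < g" for c
      using adjoint_block[OF U(1) _ that, of 0] g by (simp add: blocks_def)
    have c: "blocks n U j * mat_adjoint (blocks n U j) \<in> carrier_mat n n" for j
      by (rule mult_carrier_mat[of _ n n]) (simp_all add: blocks_def adjoint_carrier)
    have "(\<Oplus>\<^bsub>ring_mat TYPE(complex) n ()\<^esub>j\<in>{1..g}. blocks n U j * mat_adjoint (blocks n U j)) = 1\<^sub>m n"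
    proof (subst finsum_ring_mat[OF _ c], simp, rule eq_matI)
      fix a b assume "a < dim_row (1\<^sub>m n :: complex mat)" "b < dim_col (1\<^sub>m n :: complex mat)"
      then have ab: "a < n" "b < n" by auto
      have "(\<Sum>j\<in>{1..g}. (blocks n U j * mat_adjoint (blocks n U j)) $$ (a, b))
          = (\<Sum>t<g. (block n 0 t (U ()) * block n t 0 (mat_adjoint (U ()))) $$ (a, b))"
        unfolding sum_1_atMost_conv by (intro sum.cong refl) (simp add: adj, simp add: blocks_def)
      also have "\<dots> = block n 0 0 (1\<^sub>m (g * n)) $$ (a, b)"
        using block_mult[OF U(1) U' _ _ ab, of 0 0] g by (simp add: U(2))
      also have "\<dots> = 1\<^sub>m n $$ (a, b)"
        using ab block_index_less[of 0 g _ n] g by (simp add: block_def)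
      finally show "mat n n (\<lambda>(i, k). \<Sum>j\<in>{1..g}. (blocks n U j * mat_adjoint (blocks n U j)) $$ (i, k)) $$ (a, b)
          = 1\<^sub>m n $$ (a, b)"
        using ab by simp
    qed auto
    then show "star_eval n (blocks n U) f = 0\<^sub>m n n"
      using n by (intro vanish) (simp_all add: blocks_def)
  qed auto
qed

lemma block_unitary_relations_membership:
  fixes g :: nat
  assumes f: "f \<in> carrier (free_star_algebra ({1..g} \<times> {1..g}))"
    and vanish: "\<And>n A. n \<ge> 1 \<Longrightarrow> \<forall>ij\<in>{1..g} \<times> {1..g}. A ij \<in> carrier_mat n n \<Longrightarrow>
      unitary_mat (g * n) (block_matrix g n A) \<Longrightarrow> star_eval n A f = 0\<^sub>m n n"
  shows "f \<in> Idl\<^bsub>free_star_algebra ({1..g} \<times> {1..g})\<^esub>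
    ((\<lambda>(i, j). (if i = j then 1 else 0) - (\<Sum>k\<in>{1..g}. var (i, k) * avar (j, k))) ` ({1..g} \<times> {1..g})
     \<union> (\<lambda>(i, j). (if i = j then 1 else 0) - (\<Sum>k\<in>{1..g}. avar (k, i) * var (k, j))) ` ({1..g} \<times> {1..g}))"
    (is "_ \<in> Idl\<^bsub>_\<^esub> (?S1 \<union> ?S2)")
proof -
  let ?I = "{1..g} \<times> {1..g}"
  have S: "?S1 \<union> ?S2 \<subseteq> carrier (free_star_algebra ?I)"
    by (auto intro!: free_star_carrier_delta_diff free_star_carrier_mult var_carrier avar_carrier split del: if_split)
  interpret block_indexed_letters ?I "UNIV :: unit set" g "\<lambda>_. ()" "\<lambda>ij. fst ij - Suc 0" "\<lambda>ij. snd ij - Suc 0"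
    by unfold_locales auto
  show ?thesis
  proof (rule biunitary_membership[OF free_star_ideal_Idl[OF _ S] block_indexed_letters_axioms,
        where letter = "\<lambda>_ r c. (Suc r, Suc c)", OF _ _ _ _ _ f])
    fix r c :: nat assume rc: "r < g" "c < g"
    have "(if Suc r = Suc c then 1 else 0) - (\<Sum>k\<in>{1..g}. var (Suc r, k) * avar (Suc c, k)) \<in> ?S1"
      using rc by (intro image_eqI[of _ _ "(Suc r, Suc c)"]) auto
    then have "(if Suc r = Suc c then 1 else 0) - (\<Sum>k\<in>{1..g}. var (Suc r, k) * avar (Suc c, k))
        \<in> Idl\<^bsub>free_star_algebra ?I\<^esub> (?S1 \<union> ?S2)"
      by (intro Idl_generator[OF S] UnI1)
    then show "(if r = c then 1 else 0) - (\<Sum>t<g. var (Suc r, Suc t) * avar (Suc c, Suc t))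
        \<in> Idl\<^bsub>free_star_algebra ?I\<^esub> (?S1 \<union> ?S2)"
      by (simp only: sum_1_atMost_conv[of "\<lambda>k. var (Suc r, k) * avar (Suc c, k)"] nat.inject)
    have "(if Suc r = Suc c then 1 else 0) - (\<Sum>k\<in>{1..g}. avar (k, Suc r) * var (k, Suc c)) \<in> ?S2"
      using rc by (intro image_eqI[of _ _ "(Suc r, Suc c)"]) auto
    then have "(if Suc r = Suc c then 1 else 0) - (\<Sum>k\<in>{1..g}. avar (k, Suc r) * var (k, Suc c))
        \<in> Idl\<^bsub>free_star_algebra ?I\<^esub> (?S1 \<union> ?S2)"
      by (intro Idl_generator[OF S] UnI2)
    then show "(if r = c then 1 else 0) - (\<Sum>t<g. avar (Suc t, Suc r) * var (Suc t, Suc c))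
        \<in> Idl\<^bsub>free_star_algebra ?I\<^esub> (?S1 \<union> ?S2)"
      by (simp only: sum_1_atMost_conv[of "\<lambda>k. avar (k, Suc r) * var (k, Suc c)"] nat.inject)
  next
    fix n :: nat and U :: "unit \<Rightarrow> complex mat"
    assume n: "n \<ge> 1" and "\<And>k. k \<in> UNIV \<Longrightarrow> unitary_mat (g * n) (U k)"
    then have U: "unitary_mat (g * n) (U ())" by simp
    have "block_matrix g n (blocks n U) = U ()"
      using U n by (auto simp: block_matrix_def blocks_def block_def unitary_mat_def intro!: eq_matI)
    then show "star_eval n (blocks n U) f = 0\<^sub>m n n"
      using U n by (intro vanish) (simp_all add: blocks_def)
  qed auto
qed

theorem corollary1p4:
  fixes g :: nat
  shows
    "(\<forall>f \<in> carrier (free_star_algebra {1..g}).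
        (\<forall>n\<ge>1. \<forall>A. (\<forall>j\<in>{1..g}. unitary_mat n (A j))
            \<longrightarrow> star_eval n A f = 0\<^sub>m n n)
        \<longrightarrow> f \<in> Idl\<^bsub>free_star_algebra {1..g}\<^esub>
              ((\<lambda>j. 1 - var j * avar j) ` {1..g} \<union> (\<lambda>j. 1 - avar j * var j) ` {1..g}))
   \<and> (g \<ge> 2 \<longrightarrow>
      (\<forall>f \<in> carrier (free_star_algebra {1..g}).
        (\<forall>n\<ge>1. \<forall>A. (\<forall>j\<in>{1..g}. A j \<in> carrier_mat n n)
              \<and> (\<Oplus>\<^bsub>ring_mat TYPE(complex) n ()\<^esub>j\<in>{1..g}. A j * mat_adjoint (A j)) = 1\<^sub>m n
            \<longrightarrow> star_eval n A f = 0\<^sub>m n n)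
        \<longrightarrow> f \<in> Idl\<^bsub>free_star_algebra {1..g}\<^esub>
              {1 - (\<Sum>j\<in>{1..g}. var j * avar j)}))
   \<and> (\<forall>f \<in> carrier (free_star_algebra ({1..g} \<times> {1..g})).
        (\<forall>n\<ge>1. \<forall>A. (\<forall>ij\<in>{1..g} \<times> {1..g}. A ij \<in> carrier_mat n n)
              \<and> unitary_mat (g * n) (block_matrix g n A)
            \<longrightarrow> star_eval n A f = 0\<^sub>m n n)
        \<longrightarrow> f \<in> Idl\<^bsub>free_star_algebra ({1..g} \<times> {1..g})\<^esub>
              ((\<lambda>(i, j). (if i = j then 1 else 0) - (\<Sum>k\<in>{1..g}. var (i, k) * avar (j, k)))
                  ` ({1..g} \<times> {1..g})
               \<union> (\<lambda>(i, j). (if i = j then 1 else 0) - (\<Sum>k\<in>{1..g}. avar (k, i) * var (k, j)))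
                  ` ({1..g} \<times> {1..g})))"
  by (intro conjI ballI impI unitary_relations_membership coisometry_relation_membership
      block_unitary_relations_membership) blast+

end
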